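(* Let $\mathbb{K}=\mathbb{R}$ or $\mathbb{C}$, $m\ge1$, $d\ge1$, and $G\in C^\infty(\mathbb{K}^{1+d},\mathbb{K}^d)$, $G=G[x,y]$ with $x\in\mathbb{K}$, $y\in\mathbb{K}^d$. Let $(c_m,\dots,c_0)\in\mathbb{K}^{(m+1)d}$ (each $c_i\in\mathbb{K}^d$) be given with $G[0,c_0]=0$. With the quantities $T^{2i}_{y_{0,i}}$, $\bar R_i$, $\gamma_m^{2m}$ defined in the context, assume (i) $T^0_{y_{0,0}}=\cdots=T^{2(m-1)}_{y_{0,m-1}}=0\in\mathbb{K}^{d,d}$ and $\det(T^{2m}_{y_{0,m}})\neq0$; (ii) $\bar R_1(c_0)=\cdots=\bar R_{2m}(c_m,\dots,c_0)=0\in\mathbb{K}^d$. Then there exists a smooth $\mathbb{K}^d$-valued function $c_{m+1}(x)$, defined for $x$ in a neighbourhood of $0$ in $\mathbb{K}$, with $$c_{m+1}(0)=-\frac{1}{\gamma_m^{2m}}\,\bigl(T^{2m}_{y_{0,m}}\bigr)^{-1}\,\bar R_{2m+1}(c_m,\dots,c_0)$$ and $$G\Bigl[x,\ c_0+c_1x+\cdots+\frac{1}{m!}c_mx^m+\frac{1}{(m+1)!}c_{m+1}(x)\,x^{m+1}\Bigr]=0 .$$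
   Context: **Expansion coefficients.** Put $z=(x,y_0)\in\mathbb{K}^{1+d}$ with $x\in\mathbb{K}$, $y_0\in\mathbb{K}^d$ (here $y_0$ stands for $y$). For a formal series $z(\varepsilon)=\sum_{i\ge0}\frac1{i!}z_i\varepsilon^i$, $z_i=(x_i,y_{0,i})$, define $T^i(z_i,\dots,z_0)\in\mathbb{K}^d$ by the (formal Taylor) expansion $G[z(\varepsilon)]=\sum_{i\ge0}\frac1{i!}T^i(z_i,\dots,z_0)\varepsilon^i$, so $T^0=G[z_0]$, $T^1=G'[z_0]z_1$, $T^2=G'[z_0]z_2+G''[z_0]z_1^2$, etc. For $i\ge0$ let $T^{2i}_{y_{0,i}}\in\mathbb{K}^{d,d}$ be the partial derivative of $T^{2i}(z_{2i},\dots,z_0)$ with respect to the variable $y_{0,i}$ (all components of all $z_s$ being treated as independent variables); it depends only on $z_i,\dots,z_0$. **Substitution.** Given $c_0,c_1,\dots\in\mathbb{K}^d$, all $T^i$ and $T^{2i}_{y_{0,i}}$ are evaluated (after differentiation) at $x_1=1$, $x_i=0$ for $i\neq1$, and $y_{0,i}=c_i$; that is, $x=\varepsilon$ and $y(x)=\sum_i\frac1{i!}c_ix^i$. Then $T^i$ becomes a function $T^i(c_i,\dots,c_0)$, and $T^{2i}_{y_{0,i}}$ depends on $c_i,\dots,c_0$ only. **Remainders.** For $k\ge0$, $l\ge0$, $0\le t\le k$ let $$\gamma_t^{2k+l}:=\binom{2k+1+l}{t}\binom{2t}{t}^{-1}.$$ One has $$T^{2k+1+l}(c_{2k+1+l},\dots,c_0)=\sum_{t=0}^{k}\gamma_t^{2k+l}\,T^{2t}_{y_{0,t}}\,c_{2k+1+l-t}+\bar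 R_{2k+1+l}(c_{k+l},\dots,c_0),$$ which defines $\bar R_{2k+1+l}$; it depends only on $c_{k+l},\dots,c_0$. Since the splitting depends on the pair $(k,l)$, the convention is: $\bar R_1,\dots,\bar R_{2m}$ are taken with $k=0,\dots,m-1$ and $l\in\{0,1\}$, i.e. $\bar R_{2k+1}(c_k,\dots,c_0)$ with $(k,0)$ and $\bar R_{2k+2}(c_{k+1},\dots,c_0)$ with $(k,1)$; $\bar R_{2m+1}(c_m,\dots,c_0)$ is taken with the pair $(m,0)$. *)

theory Defs
  imports "HOL-Analysis.Analysis"
begin

text \<open>
  The scalar field. Up to isomorphism the only types of this class are the real and the complex
  numbers: by Frobenius' theorem these are the only finite-dimensional commutative real division
  algebras, and the multiplicative norm is then the usual absolute value.
\<close>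

class real_or_complex = real_normed_field + euclidean_space

instance real :: real_or_complex ..
instance complex :: real_or_complex ..

text \<open>
  Points \<open>(x, y)\<close> of the \<open>1 + d\<close>-dimensional space are of type \<open>'k \<times> ('k ^ 'd)\<close>, where \<open>d = CARD('d)\<close>.
\<close>

abbreviation pair_scale :: "'k::real_or_complex \<Rightarrow> 'k \<times> ('k ^ 'd) \<Rightarrow> 'k \<times> ('k ^ 'd)"
  where "pair_scale \<equiv> module_prod.scale (*) (*s)"

lemma pair_scale_eq: "pair_scale a z = (a * fst z, a *s snd z)"
proof -
  have "module_prod ((*) :: 'a \<Rightarrow> 'a \<Rightarrow> 'a) ((*s) :: 'a \<Rightarrow> 'a ^ 'b \<Rightarrow> 'a ^ 'b)"
    by unfold_locales (simp_all add: algebra_simps)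
  then show ?thesis by (rule module_prod.scale_def)
qed

text \<open>
  \<open>C_diff_on sc n S f\<close>: \<open>f\<close> is \<open>n\<close> times continuously differentiable over the field \<open>'k\<close> on the
  open set \<open>S\<close>; \<open>sc\<close> is the scalar multiplication of the domain. The library's Frechet derivative
  is only real-linear, so linearity over \<open>'k\<close> is required separately: for complex scalars
  this is complex differentiability, for real scalars it holds automatically.
\<close>

primrec C_diff_on ::
    "('k::real_or_complex \<Rightarrow> 'a \<Rightarrow> 'a) \<Rightarrow> nat \<Rightarrow> 'a::real_normed_vector set \<Rightarrow> ('a \<Rightarrow> 'k ^ 'd) \<Rightarrow> bool"
  where
    "C_diff_on sc 0 S f \<longleftrightarrow> continuous_on S f"
  | "C_diff_on sc (Suc n) S f \<longleftrightarrow>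
       (\<forall>x\<in>S. f differentiable (at x) \<and>
              Vector_Spaces.linear sc (*s) (frechet_derivative f (at x))) \<and>
       (\<forall>v. C_diff_on sc n S (\<lambda>x. frechet_derivative f (at x) v))"

definition smooth_on ::
    "('k::real_or_complex \<Rightarrow> 'a \<Rightarrow> 'a) \<Rightarrow> 'a::real_normed_vector set \<Rightarrow> ('a \<Rightarrow> 'k ^ 'd) \<Rightarrow> bool"
  where "smooth_on sc S f \<longleftrightarrow> (\<forall>n. C_diff_on sc n S f)"

text \<open>
  \<open>T_coeff G i z\<close> is \<open>i!\<close> times the coefficient of \<open>\<epsilon>\<^sup>i\<close> in the Taylor expansion of \<open>G\<close> along
  \<open>z(\<epsilon>) = \<Sum>\<^sub>j z\<^sub>j \<epsilon>\<^sup>j / j!\<close>. Terms of \<open>z(\<epsilon>)\<close> of order above \<open>i\<close> do not contribute to it, so the series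
  is cut off there and no convergence is needed.
\<close>

definition T_coeff :: "('k::real_or_complex \<times> ('k ^ 'd) \<Rightarrow> 'k ^ 'd) \<Rightarrow> nat \<Rightarrow> (nat \<Rightarrow> 'k \<times> ('k ^ 'd)) \<Rightarrow> 'k ^ 'd"
  where "T_coeff G i z =
    (\<chi> p. (deriv ^^ i) (\<lambda>\<epsilon>. G (\<Sum>j\<le>i. pair_scale (\<epsilon> ^ j / fact j) (z j)) $ p) 0)"

lemma T_coeff_0: "T_coeff G 0 z = G (z 0)"
  by (simp add: T_coeff_def pair_scale_eq)

text \<open>
  The Jacobian matrix of \<open>T\<^sup>2\<^sup>i\<close> with respect to the \<open>y\<close>-part of the variable \<open>z\<^sub>i\<close>, all other
  variables being kept fixed.
\<close>

definition T_coeff_y :: "('k::real_or_complex \<times> ('k ^ 'd) \<Rightarrow> 'k ^ 'd) \<Rightarrow> nat \<Rightarrow> (nat \<Rightarrow> 'k \<times> ('k ^ 'd)) \<Rightarrow> 'k ^ 'd ^ 'd"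
  where "T_coeff_y G i z =
    (\<chi> p q. deriv (\<lambda>s. T_coeff G (2 * i) (z(i := (fst (z i), snd (z i) + axis q s))) $ p) 0)"

text \<open>The coefficients of the curve \<open>x = \<epsilon>\<close>, \<open>y = \<Sum>\<^sub>i c\<^sub>i \<epsilon>\<^sup>i / i!\<close>.\<close>

definition graph_coeffs :: "(nat \<Rightarrow> 'k ^ 'd) \<Rightarrow> nat \<Rightarrow> 'k::real_or_complex \<times> ('k ^ 'd)"
  where "graph_coeffs c i = (if i = 1 then 1 else 0, c i)"

text \<open>\<open>gamma t n\<close> is \<open>\<gamma>\<close> with lower index \<open>t\<close> and upper index \<open>n = 2k + l\<close>.\<close>

definition gamma :: "nat \<Rightarrow> nat \<Rightarrow> 'k::real_or_complex"
  where "gamma t n = of_nat ((n + 1) choose t) / of_nat ((2 * t) choose t)"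

text \<open>
  The remainder of order \<open>2k + 1 + l\<close> for the splitting given by the pair \<open>(k, l)\<close>. Although the
  whole sequence \<open>c\<close> is an argument, for smooth \<open>G\<close> the value depends only on \<open>c\<^sub>0, \<dots>, c\<^sub>k\<^sub>+\<^sub>l\<close>; likewise
  \<open>T_coeff_y G i (graph_coeffs c)\<close> depends only on \<open>c\<^sub>0, \<dots>, c\<^sub>i\<close>.
\<close>

definition R_bar ::
    "('k::real_or_complex \<times> ('k ^ 'd) \<Rightarrow> 'k ^ 'd) \<Rightarrow> nat \<Rightarrow> nat \<Rightarrow> (nat \<Rightarrow> 'k ^ 'd) \<Rightarrow> 'k ^ 'd"
  where "R_bar G k l c =
    T_coeff G (2 * k + 1 + l) (graph_coeffs c)
    - (\<Sum>t\<le>k. gamma t (2 * k + l) *s (T_coeff_y G t (graph_coeffs c) *v c (2 * k + 1 + l - t)))"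

end

theory Submission
  imports Defs "HOL-Library.Landau_Symbols"
begin

text \<open>
  Let \<open>p(x) = c\<^sub>0 + c\<^sub>1 x + \<dots> + c\<^sub>m x\<^sup>m / m!\<close>, let \<open>Y\<close> be the Taylor polynomial with the coefficients
  \<open>c\<^sub>0, \<dots>, c\<^sub>2\<^sub>m\<^sub>+\<^sub>1\<close>, and let \<open>A(x) = G\<^sub>y[x, Y(x)]\<close>. A change of \<open>c\<^sub>i\<close> by \<open>v\<close> changes the curve by \<open>x\<^sup>i v / i!\<close>
  and hence \<open>G\<close> along the curve, to first order, by \<open>x\<^sup>i A(x) v / i!\<close>. Comparing coefficients of order
  \<open>2i\<close>, one finds that \<open>T\<^sup>2\<^sup>i\<close> has the Jacobian matrix \<open>binom(2i, i) A\<^sup>(\<^sup>i\<^sup>)(0)\<close> with respect to \<open>c\<^sub>i\<close>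
  (\<open>T_coeff_y_eq_higher_deriv\<close>). So assumption (i) says that \<open>A\<close> vanishes at \<open>0\<close> exactly to order \<open>m\<close>,
  with an invertible leading coefficient. Under (i) all subtracted terms in the remainders of (ii) are
  \<open>0\<close>, and (ii) together with \<open>G[0, c\<^sub>0] = 0\<close> says that \<open>T\<^sup>0, \<dots>, T\<^sup>2\<^sup>m\<close> vanish, that is, \<open>G[x, Y(x)] = O(x\<^sup>2\<^sup>m\<^sup>+\<^sup>1)\<close>.

  Now blow up the equation: put \<open>F(x, w) = G[x, p(x) + x\<^sup>m\<^sup>+\<^sup>1 w / (m + 1)!]\<close>. The curve inside differs
  from \<open>Y\<close> by \<open>h = O(x\<^sup>m\<^sup>+\<^sup>1)\<close>. The effect of \<open>h\<close> on \<open>G\<close> is \<open>A h + O(|h|\<^sup>2)\<close>, where \<open>A h = O(x\<^sup>2\<^sup>m\<^sup>+\<^sup>1)\<close> and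
  \<open>|h|\<^sup>2 = O(x\<^sup>2\<^sup>m\<^sup>+\<^sup>2)\<close>. Consequently the derivatives of \<open>F(\<cdot>, w)\<close> at \<open>0\<close> vanish up to order \<open>2m\<close>, and the one
  of order \<open>2m + 1\<close> is the affine function \<open>R + \<gamma> J w\<close> of \<open>w\<close>, where \<open>R\<close> is the last remainder, \<open>J\<close> the
  invertible matrix of (i) and \<open>\<gamma> = \<gamma>\<^sub>m\<^sup>2\<^sup>m\<close> (\<open>higher_deriv_shifted_curve\<close>).

  Therefore \<open>F(x, w) = x\<^sup>2\<^sup>m\<^sup>+\<^sup>1 H(x, w)\<close> with a function \<open>H\<close> that is smooth in both variables
  (\<open>iterated_Hadamard_division\<close>), and \<open>H(0, w) = (R + \<gamma> J w) / (2m + 1)!\<close>. This vanishes at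
  \<open>w = - \<gamma>\<^sup>-\<^sup>1 J\<^sup>-\<^sup>1 R\<close> and has an invertible derivative in \<open>w\<close>, so the implicit function theorem, in a
  version with smooth solutions (\<open>implicit_function_smooth\<close>), solves \<open>H(x, u(x)) = 0\<close>.

  The real and the complex case are treated together: Taylor's formula enters only through estimates,
  and the only integrals are over a real parameter in \<open>[0, 1]\<close>.
\<close>

section \<open>Scalar functions of class \<open>C\<^sup>n\<close> over the field\<close>

text \<open>
  The condition that \<^const>\<open>C_diff_on\<close> on an open set imposes on each component. The gain is that
  scalar-valued functions can be multiplied and inverted, so that polynomials, determinants and
  Cramer's rule are covered by a few closure rules. Homogeneity together with the additivity of the
  Frechet derivative is linearity over \<open>'k\<close>.
\<close>

primrec C_scalar ::
    "('k::real_or_complex \<Rightarrow> 'a \<Rightarrow> 'a) \<Rightarrow> nat \<Rightarrow> 'a::real_normed_vector set \<Rightarrow> ('a \<Rightarrow> 'k) \<Rightarrow> bool"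
  where
    "C_scalar sc 0 S f \<longleftrightarrow> continuous_on S f"
  | "C_scalar sc (Suc n) S f \<longleftrightarrow>
       (\<forall>x\<in>S. f differentiable (at x) \<and>
              (\<forall>a v. frechet_derivative f (at x) (sc a v) = a * frechet_derivative f (at x) v)) \<and>
       (\<forall>v. C_scalar sc n S (\<lambda>x. frechet_derivative f (at x) v))"

lemma C_scalar_has_derivative:
  assumes "C_scalar sc (Suc n) S f" "x \<in> S"
  shows "(f has_derivative frechet_derivative f (at x)) (at x)"
  using assms by (simp add: frechet_derivative_works)

lemma C_scalar_hom:
  assumes "C_scalar sc (Suc n) S f" "x \<in> S"
  shows "frechet_derivative f (at x) (sc a v) = a * frechet_derivative f (at x) v"
  using assms by simp

lemma C_scalar_frechet:
  "C_scalar sc (Suc n) S f \<Longrightarrow> C_scalar sc n S (\<lambda>x. frechet_derivative f (at x) v)"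
  unfolding C_scalar.simps by blast

lemma C_scalar_SucD: "C_scalar sc (Suc n) S f \<Longrightarrow> C_scalar sc n S f"
proof (induction n arbitrary: f)
  case 0
  then show ?case
    by (auto intro!: differentiable_imp_continuous_on simp: differentiable_on_def differentiable_at_withinI)
next
  case (Suc n)
  note pr = Suc.prems[unfolded C_scalar.simps(2)[of sc "Suc n" S f]]
  show ?case
    unfolding C_scalar.simps(2)[of sc n S f] using pr Suc.IH by blast
qed

lemma C_scalar_continuous: "C_scalar sc n S f \<Longrightarrow> continuous_on S f"
proof (induction n)
  case (Suc n)
  then show ?case using C_scalar_SucD by blast
qed simp

lemma C_scalar_cong:
  assumes "open S" "C_scalar sc n S f" "\<And>x. x \<in> S \<Longrightarrow> f x = g x"
  shows "C_scalar sc n S g"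
  using assms(2,3)
proof (induction n arbitrary: f g)
  case 0
  then show ?case by (auto cong: continuous_on_cong)
next
  case (Suc n)
  have der: "(g has_derivative frechet_derivative f (at x)) (at x)" if "x \<in> S" for x
    using C_scalar_has_derivative[OF Suc.prems(1) that] assms(1) that
    by (rule has_derivative_transform_within_open) (use Suc.prems(2) in auto)
  have fd: "frechet_derivative g (at x) = frechet_derivative f (at x)" if "x \<in> S" for x
    using frechet_derivative_at[OF der[OF that]] by simp
  have "C_scalar sc n S (\<lambda>x. frechet_derivative g (at x) v)" for v
    by (rule Suc.IH[of "\<lambda>x. frechet_derivative f (at x) v"]) (use Suc.prems(1) fd in auto)
  then show ?case
    using der fd Suc.prems(1) by (auto simp: differentiable_def)
qed

text \<open>
  The working form of the recursive clause: on an open set, any family of derivatives can take the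
  place of \<^const>\<open>frechet_derivative\<close>.
\<close>

lemma C_scalar_SucI:
  assumes "open S"
    and "\<And>x. x \<in> S \<Longrightarrow> (f has_derivative D x) (at x)"
    and "\<And>x a v. x \<in> S \<Longrightarrow> D x (sc a v) = a * D x v"
    and "\<And>v. C_scalar sc n S (\<lambda>x. D x v)"
  shows "C_scalar sc (Suc n) S f"
proof -
  have fd: "frechet_derivative f (at x) = D x" if "x \<in> S" for x
    using frechet_derivative_at[OF assms(2)[OF that]] by simp
  have "C_scalar sc n S (\<lambda>x. frechet_derivative f (at x) v)" for v
    by (rule C_scalar_cong[OF assms(1) assms(4)[of v]]) (simp add: fd)
  then show ?thesis
    using assms(2,3) fd by (auto simp: differentiable_def)
qed

lemma C_scalar_const: "open S \<Longrightarrow> C_scalar sc n S (\<lambda>x. k)"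
proof (induction n arbitrary: k)
  case (Suc n)
  show ?case by (rule C_scalar_SucI[where D="\<lambda>_ _. 0"]) (use Suc in auto)
qed simp

lemma C_scalar_add:
  assumes "open S"
  shows "C_scalar sc n S f \<Longrightarrow> C_scalar sc n S g \<Longrightarrow> C_scalar sc n S (\<lambda>x. f x + g x)"
proof (induction n arbitrary: f g)
  case 0
  then show ?case by (auto intro: continuous_intros)
next
  case (Suc n)
  show ?case
  proof (rule C_scalar_SucI[OF assms,
        where D="\<lambda>x v. frechet_derivative f (at x) v + frechet_derivative g (at x) v"])
    show "C_scalar sc n S (\<lambda>x. frechet_derivative f (at x) v + frechet_derivative g (at x) v)" for v
      using Suc by simp
  qed (use Suc.prems in \<open>auto intro!: has_derivative_add C_scalar_has_derivative[of _ _ S] simp: algebra_simps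
        simp del: C_scalar.simps simp: C_scalar_hom\<close>)
qed

lemma C_scalar_mult:
  assumes "open S"
  shows "C_scalar sc n S f \<Longrightarrow> C_scalar sc n S g \<Longrightarrow> C_scalar sc n S (\<lambda>x. f x * g x)"
proof (induction n arbitrary: f g)
  case 0
  then show ?case by (auto intro: continuous_intros)
next
  case (Suc n)
  show ?case
  proof (rule C_scalar_SucI[OF assms,
        where D="\<lambda>x v. f x * frechet_derivative g (at x) v + frechet_derivative f (at x) v * g x"])
    show "C_scalar sc n S (\<lambda>x. f x * frechet_derivative g (at x) v + frechet_derivative f (at x) v * g x)" for v
      using Suc C_scalar_SucD[of sc n S f] C_scalar_SucD[of sc n S g]
      by (intro C_scalar_add[OF assms] Suc.IH) auto
  next
    fix x assume "x \<in> S"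
    then show "((\<lambda>x. f x * g x) has_derivative
        (\<lambda>v. f x * frechet_derivative g (at x) v + frechet_derivative f (at x) v * g x)) (at x)"
      by (intro has_derivative_mult C_scalar_has_derivative[OF Suc.prems(1)]
          C_scalar_has_derivative[OF Suc.prems(2)])
  qed (use Suc.prems in \<open>auto simp: algebra_simps simp del: C_scalar.simps simp: C_scalar_hom\<close>)
qed

lemma C_scalar_sum:
  assumes "open S"
  shows "(\<And>i. i \<in> I \<Longrightarrow> C_scalar sc n S (f i)) \<Longrightarrow> C_scalar sc n S (\<lambda>x. \<Sum>i\<in>I. f i x)"
  by (induction I rule: infinite_finite_induct)
    (use assms in \<open>auto intro: C_scalar_add C_scalar_const\<close>)

lemma C_scalar_prod:
  assumes "open S"
  shows "(\<And>i. i \<in> I \<Longrightarrow> C_scalar sc n S (f i)) \<Longrightarrow> C_scalar sc n S (\<lambda>x. \<Prod>i\<in>I. f i x)"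
  by (induction I rule: infinite_finite_induct)
    (use assms in \<open>auto intro: C_scalar_mult C_scalar_const\<close>)

lemma C_scalar_power:
  assumes "open S" "C_scalar sc n S f"
  shows "C_scalar sc n S (\<lambda>x. f x ^ k)"
  by (induction k) (use assms in \<open>auto intro: C_scalar_mult C_scalar_const\<close>)

lemma C_scalar_minus:
  assumes "open S" "C_scalar sc n S f"
  shows "C_scalar sc n S (\<lambda>x. - f x)"
  using C_scalar_mult[OF assms(1) C_scalar_const[OF assms(1)] assms(2), of "-1"] by simp

lemma C_scalar_diff:
  assumes "open S" "C_scalar sc n S f" "C_scalar sc n S g"
  shows "C_scalar sc n S (\<lambda>x. f x - g x)"
  using C_scalar_add[OF assms(1,2) C_scalar_minus[OF assms(1,3)]] by simp

lemma C_scalar_linear: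
  assumes "open S" "bounded_linear L" "\<And>a v. L (sc a v) = a * L v"
  shows "C_scalar sc n S L"
proof (cases n)
  case 0
  then show ?thesis using assms(2) by (simp add: linear_continuous_on)
next
  case (Suc k)
  show ?thesis unfolding Suc
    by (rule C_scalar_SucI[where D="\<lambda>_. L"])
      (use assms in \<open>auto intro: bounded_linear_imp_has_derivative C_scalar_const\<close>)
qed

lemma C_scalar_inverse:
  assumes "open S"
  shows "C_scalar sc n S f \<Longrightarrow> (\<And>x. x \<in> S \<Longrightarrow> f x \<noteq> 0) \<Longrightarrow> C_scalar sc n S (\<lambda>x. inverse (f x))"
proof (induction n)
  case 0
  then show ?case by (auto intro: continuous_intros)
next
  case (Suc n)
  have inv: "C_scalar sc n S (\<lambda>x. inverse (f x))"
    using Suc C_scalar_SucD by blast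
  show ?case
  proof (rule C_scalar_SucI[OF assms,
        where D="\<lambda>x v. - (inverse (f x) * frechet_derivative f (at x) v * inverse (f x))"])
    show "C_scalar sc n S (\<lambda>x. - (inverse (f x) * frechet_derivative f (at x) v * inverse (f x)))" for v
      using Suc.prems by (intro C_scalar_minus[OF assms] C_scalar_mult[OF assms] inv) auto
  next
    fix x assume "x \<in> S"
    then show "((\<lambda>x. inverse (f x)) has_derivative
        (\<lambda>v. - (inverse (f x) * frechet_derivative f (at x) v * inverse (f x)))) (at x)"
      by (intro Deriv.has_derivative_inverse C_scalar_has_derivative[OF Suc.prems(1)] Suc.prems(2))
  qed (use Suc.prems in \<open>auto simp: algebra_simps simp del: C_scalar.simps simp: C_scalar_hom\<close>)
qed

lemma C_scalar_det:
  fixes M :: "'a::real_normed_vector \<Rightarrow> 'k::real_or_complex ^ 'd ^ 'd"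
  assumes "open S" "\<And>i j. C_scalar sc n S (\<lambda>x. M x $ i $ j)"
  shows "C_scalar sc n S (\<lambda>x. det (M x))"
  unfolding det_def
  by (intro C_scalar_sum C_scalar_mult C_scalar_const C_scalar_prod assms)

lemma has_derivative_vec_lambda:
  fixes f :: "'d::finite \<Rightarrow> 'b::real_normed_vector \<Rightarrow> 'k::euclidean_space"
  assumes "\<And>p. (f p has_derivative f' p) (at x within S)"
  shows "((\<lambda>x. \<chi> p. f p x) has_derivative (\<lambda>v. \<chi> p. f' p v)) (at x within S)"
proof -
  have lin: "bounded_linear (axis p :: 'k \<Rightarrow> 'k ^ 'd)" for p
    unfolding linear_conv_bounded_linear[symmetric]
    by (rule linearI) (auto simp: vec_eq_iff axis_def)
  have eq: "(\<chi> p. h p) = (\<Sum>p\<in>UNIV. axis p (h p))" for h :: "'d \<Rightarrow> 'k"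
    by (auto simp: vec_eq_iff axis_def sum.If_cases if_distrib[where f="\<lambda>z. z $ _"])
  show ?thesis
    unfolding eq using assms by (intro has_derivative_sum bounded_linear.has_derivative[OF lin])
qed

text \<open>
  A functional on \<open>'k \<times> 'k ^ 'd\<close> is determined by its values on the standard basis over \<open>'k\<close>. This
  writes every directional derivative as a combination, with scalar coefficients, of finitely many
  fixed ones, which is what keeps the inductions over the order of differentiability going.
\<close>

lemma pair_scale_expand:
  fixes D :: "'k::real_or_complex \<times> ('k ^ 'd) \<Rightarrow> 'k"
  assumes "linear D" "\<And>a v. D (pair_scale a v) = a * D v"
  shows "D (a, w) = a * D (1, 0) + (\<Sum>p\<in>UNIV. w $ p * D (0, axis p 1))"
proof -
  have w: "w = (\<Sum>p\<in>UNIV. w $ p *s axis p 1)"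
    by (simp add: basis_expansion)
  have "(a, w) = pair_scale a (1, 0) + (\<Sum>p\<in>UNIV. pair_scale (w $ p) (0, axis p 1))"
    by (subst w) (simp add: pair_scale_eq prod_eq_iff fst_sum snd_sum)
  then have "D (a, w) = D (pair_scale a (1, 0)) + (\<Sum>p\<in>UNIV. D (pair_scale (w $ p) (0, axis p 1)))"
    using assms(1) by (simp add: linear_add linear_sum)
  then show ?thesis by (simp add: assms(2))
qed

text \<open>
  By the chain rule and \<open>pair_scale_expand\<close> the derivative of a composition is a sum of products of
  derivatives of \<open>g\<close> with compositions of the same kind, one order of differentiability lower.
\<close>

lemma C_scalar_compose:
  fixes \<Phi> :: "'k::real_or_complex \<times> ('k ^ 'd) \<Rightarrow> 'k" and g :: "'b::real_normed_vector \<Rightarrow> 'k \<times> ('k ^ 'd)"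
  assumes "open S" "open T" "g ` T \<subseteq> S"
  shows "C_scalar pair_scale n S \<Phi> \<Longrightarrow> C_scalar sc n T (\<lambda>x. fst (g x)) \<Longrightarrow>
    (\<And>p. C_scalar sc n T (\<lambda>x. snd (g x) $ p)) \<Longrightarrow> C_scalar sc n T (\<lambda>x. \<Phi> (g x))"
proof (induction n arbitrary: \<Phi>)
  case 0
  have "continuous_on T (\<lambda>x. (fst (g x), \<chi> p. snd (g x) $ p))"
    using 0 by (intro continuous_on_Pair continuous_on_vec_lambda) auto
  then have "continuous_on T g" by simp
  with 0(1) assms(3) show ?case
    by (auto intro: continuous_on_compose2)
next
  case (Suc n)
  define D0 where "D0 x = frechet_derivative (\<lambda>x. fst (g x)) (at x)" for x
  define Dp where "Dp p x = frechet_derivative (\<lambda>x. snd (g x) $ p) (at x)" for p x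
  have D0: "((\<lambda>x. fst (g x)) has_derivative D0 x) (at x)" if "x \<in> T" for x
    unfolding D0_def using Suc.prems(2) that by (rule C_scalar_has_derivative)
  have Dp: "((\<lambda>x. snd (g x) $ p) has_derivative Dp p x) (at x)" if "x \<in> T" for x p
    unfolding Dp_def using Suc.prems(3) that by (rule C_scalar_has_derivative)
  have Dg: "(g has_derivative (\<lambda>v. (D0 x v, \<chi> p. Dp p x v))) (at x)" if "x \<in> T" for x
    using has_derivative_Pair[OF D0[OF that] has_derivative_vec_lambda[OF Dp[OF that], of "\<lambda>p. p"]] by simp
  define E where "E v z = frechet_derivative \<Phi> (at z) v" for v z
  have lin: "linear (\<lambda>v. E v z)" if "z \<in> S" for z
    unfolding E_def using linear_frechet_derivative Suc.prems(1) that by auto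
  have hom: "E (pair_scale a v) z = a * E v z" if "z \<in> S" for z a v
    unfolding E_def using C_scalar_hom[OF Suc.prems(1) that] .
  have expand: "E (a, w) z = a * E (1,0) z + (\<Sum>p\<in>UNIV. w $ p * E (0, axis p 1) z)"
    if "z \<in> S" for z a w
    using pair_scale_expand[OF lin[OF that] hom[OF that]] .
  have E: "C_scalar sc n T (\<lambda>x. E v (g x))" for v
    by (rule Suc.IH[OF _ C_scalar_SucD[OF Suc.prems(2)] C_scalar_SucD[OF Suc.prems(3)]])
      (unfold E_def, rule C_scalar_frechet[OF Suc.prems(1)])
  show ?case
  proof (rule C_scalar_SucI[OF assms(2), where D = "\<lambda>x v. D0 x v * E (1,0) (g x)
        + (\<Sum>p\<in>UNIV. Dp p x v * E (0, axis p 1) (g x))"])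
    fix x assume x: "x \<in> T"
    with assms(3) have gx: "g x \<in> S" by auto
    have "(\<Phi> has_derivative (\<lambda>v. E v (g x))) (at (g x))"
      unfolding E_def using Suc.prems(1) gx by (rule C_scalar_has_derivative)
    from has_derivative_compose[OF Dg[OF x] this]
    show "((\<lambda>x. \<Phi> (g x)) has_derivative (\<lambda>v. D0 x v * E (1,0) (g x)
        + (\<Sum>p\<in>UNIV. Dp p x v * E (0, axis p 1) (g x)))) (at x)"
      by (simp add: expand[OF gx, of "D0 x _"])
  next
    fix x a v assume x: "x \<in> T"
    show "D0 x (sc a v) * E (1,0) (g x) + (\<Sum>p\<in>UNIV. Dp p x (sc a v) * E (0, axis p 1) (g x))
      = a * (D0 x v * E (1,0) (g x) + (\<Sum>p\<in>UNIV. Dp p x v * E (0, axis p 1) (g x)))"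
      unfolding D0_def Dp_def
      by (simp only: C_scalar_hom[OF Suc.prems(2) x] C_scalar_hom[OF Suc.prems(3) x]
          sum_distrib_left distrib_left mult.assoc)
  next
    fix v
    show "C_scalar sc n T (\<lambda>x. D0 x v * E (1,0) (g x) + (\<Sum>p\<in>UNIV. Dp p x v * E (0, axis p 1) (g x)))"
      using Suc.prems unfolding D0_def Dp_def
      by (intro C_scalar_add C_scalar_sum C_scalar_mult assms E) auto
  qed
qed

definition smooth_scalar ::
    "('k::real_or_complex \<Rightarrow> 'a \<Rightarrow> 'a) \<Rightarrow> 'a::real_normed_vector set \<Rightarrow> ('a \<Rightarrow> 'k) \<Rightarrow> bool"
  where "smooth_scalar sc S f \<longleftrightarrow> (\<forall>n. C_scalar sc n S f)"

lemma smooth_scalar_D: "smooth_scalar sc S f \<Longrightarrow> C_scalar sc n S f"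
  by (simp add: smooth_scalar_def)

lemma smooth_scalar_frechet:
  "smooth_scalar sc S f \<Longrightarrow> smooth_scalar sc S (\<lambda>x. frechet_derivative f (at x) v)"
  unfolding smooth_scalar_def using C_scalar_frechet by blast

lemma smooth_scalar_add: "open S \<Longrightarrow> smooth_scalar sc S f \<Longrightarrow> smooth_scalar sc S g \<Longrightarrow> smooth_scalar sc S (\<lambda>x. f x + g x)"
  and smooth_scalar_diff: "open S \<Longrightarrow> smooth_scalar sc S f \<Longrightarrow> smooth_scalar sc S g \<Longrightarrow> smooth_scalar sc S (\<lambda>x. f x - g x)"
  and smooth_scalar_mult: "open S \<Longrightarrow> smooth_scalar sc S f \<Longrightarrow> smooth_scalar sc S g \<Longrightarrow> smooth_scalar sc S (\<lambda>x. f x * g x)"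
  and smooth_scalar_const: "open S \<Longrightarrow> smooth_scalar sc S (\<lambda>x. k)"
  and smooth_scalar_power: "open S \<Longrightarrow> smooth_scalar sc S f \<Longrightarrow> smooth_scalar sc S (\<lambda>x. f x ^ j)"
  and smooth_scalar_sum: "open S \<Longrightarrow> (\<And>i. i \<in> I \<Longrightarrow> smooth_scalar sc S (F i)) \<Longrightarrow> smooth_scalar sc S (\<lambda>x. \<Sum>i\<in>I. F i x)"
  by (auto simp: smooth_scalar_def intro!: C_scalar_add C_scalar_diff C_scalar_mult C_scalar_const
      C_scalar_power C_scalar_sum)

abbreviation smooth_fun :: "('k::real_or_complex \<Rightarrow> 'k) \<Rightarrow> bool"
  where "smooth_fun \<equiv> smooth_scalar (*) UNIV"

lemma smooth_fun_id: "smooth_fun (\<lambda>x. x)"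
  unfolding smooth_scalar_def by (auto intro!: C_scalar_linear)

lemmas smooth_intros = smooth_scalar_add smooth_scalar_diff smooth_scalar_mult smooth_scalar_const
  smooth_scalar_power smooth_scalar_sum smooth_fun_id

lemma smooth_fun_along_curve:
  assumes "smooth_scalar pair_scale UNIV g" "\<And>q. smooth_fun (\<lambda>x. y x $ q)"
  shows "smooth_fun (\<lambda>x. g (x, y x))"
  unfolding smooth_scalar_def
proof (rule allI, rule C_scalar_compose[OF open_UNIV open_UNIV, where g = "\<lambda>x. (x, y x)"])
  show "C_scalar pair_scale n UNIV g" for n
    using assms(1) by (simp add: smooth_scalar_def)
  show "C_scalar (*) n UNIV (\<lambda>x. fst (x, y x))" for n
    by (simp add: smooth_fun_id[unfolded smooth_scalar_def, rule_format])
  show "C_scalar (*) n UNIV (\<lambda>x. snd (x, y x) $ q)" for n q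
    using assms(2)[of q] by (simp add: smooth_scalar_def)
qed simp

definition partial_y :: "('k::real_or_complex \<times> ('k ^ 'd) \<Rightarrow> 'k) \<Rightarrow> 'd \<Rightarrow> 'k \<times> ('k ^ 'd) \<Rightarrow> 'k"
  where "partial_y g q z = frechet_derivative g (at z) (0, axis q 1)"

lemma smooth_partial_y: "smooth_scalar pair_scale UNIV g \<Longrightarrow> smooth_scalar pair_scale UNIV (partial_y g q)"
  unfolding partial_y_def[abs_def] by (rule smooth_scalar_frechet)

section \<open>Derivatives at the origin and order of vanishing\<close>

text \<open>
  For functions of one variable the \<open>'k\<close>-linear Frechet derivative is multiplication by
  \<^const>\<open>deriv\<close>, in terms of which the coefficients \<open>T\<close> are defined.
\<close>

lemma smooth_fun_has_deriv:
  assumes "smooth_fun f"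
  shows "(f has_field_derivative deriv f x) (at x)" "smooth_fun (deriv f)"
proof -
  have C: "C_scalar (*) (Suc n) UNIV f" for n
    using assms by (simp only: smooth_scalar_def)
  have "frechet_derivative f (at x) v = frechet_derivative f (at x) 1 * v" for x v
    using C_scalar_hom[OF C, of x v 1] by (simp add: mult.commute)
  then have "frechet_derivative f (at x) = (\<lambda>v. frechet_derivative f (at x) 1 * v)" for x
    by blast
  then have der: "(f has_field_derivative frechet_derivative f (at x) 1) (at x)" for x
    using C_scalar_has_derivative[OF C, of x] by (simp add: has_field_derivative_def)
  then have eq: "deriv f = (\<lambda>x. frechet_derivative f (at x) 1)"
    by (auto intro: DERIV_imp_deriv)
  show "(f has_field_derivative deriv f x) (at x)"
    using der eq by simp
  show "smooth_fun (deriv f)"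
    unfolding eq smooth_scalar_def using C_scalar_frechet[OF C] by blast
qed

lemma smooth_fun_higher_deriv: "smooth_fun f \<Longrightarrow> smooth_fun ((deriv ^^ n) f)"
  by (induction n) (auto intro: smooth_fun_has_deriv)

lemma higher_deriv_add:
  "smooth_fun f \<Longrightarrow> smooth_fun g \<Longrightarrow> (deriv ^^ n) (\<lambda>x. f x + g x) x = (deriv ^^ n) f x + (deriv ^^ n) g x"
proof (induction n arbitrary: x)
  case (Suc n)
  have "(deriv ^^ n) (\<lambda>x. f x + g x) = (\<lambda>x. (deriv ^^ n) f x + (deriv ^^ n) g x)"
    using Suc by blast
  moreover have "((\<lambda>x. (deriv ^^ n) f x + (deriv ^^ n) g x) has_field_derivative
      deriv ((deriv ^^ n) f) x + deriv ((deriv ^^ n) g) x) (at x)"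
    by (intro DERIV_add smooth_fun_has_deriv smooth_fun_higher_deriv Suc.prems)
  ultimately show ?case by (simp add: DERIV_imp_deriv)
qed simp

lemma higher_deriv_cmult:
  "smooth_fun f \<Longrightarrow> (deriv ^^ n) (\<lambda>x. a * f x) x = a * (deriv ^^ n) f x"
proof (induction n arbitrary: x)
  case (Suc n)
  have "(deriv ^^ n) (\<lambda>x. a * f x) = (\<lambda>x. a * (deriv ^^ n) f x)"
    using Suc by blast
  moreover have "((\<lambda>x. a * (deriv ^^ n) f x) has_field_derivative a * deriv ((deriv ^^ n) f) x) (at x)"
    by (intro DERIV_cmult smooth_fun_has_deriv smooth_fun_higher_deriv Suc.prems)
  ultimately show ?case by (simp add: DERIV_imp_deriv)
qed simp

lemma higher_deriv_diff:
  assumes "smooth_fun f" "smooth_fun g"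
  shows "(deriv ^^ n) (\<lambda>x. f x - g x) x = (deriv ^^ n) f x - (deriv ^^ n) g x"
proof -
  have "(deriv ^^ n) (\<lambda>x. (f x - g x) + g x) x = (deriv ^^ n) (\<lambda>x. f x - g x) x + (deriv ^^ n) g x"
    by (intro higher_deriv_add smooth_intros assms open_UNIV)
  then show ?thesis by simp
qed

lemma higher_deriv_zero: "(deriv ^^ n) (\<lambda>x. 0 :: 'k::real_or_complex) x = 0"
proof -
  have "(deriv ^^ n) (\<lambda>x. 0 * (0::'k)) x = 0 * (deriv ^^ n) (\<lambda>x. 0 :: 'k) x"
    by (intro higher_deriv_cmult smooth_intros open_UNIV)
  then show ?thesis by simp
qed

lemma higher_deriv_sum:
  assumes "\<And>i. i \<in> I \<Longrightarrow> smooth_fun (F i)"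
  shows "(deriv ^^ n) (\<lambda>x. \<Sum>i\<in>I. F i x) x = (\<Sum>i\<in>I. (deriv ^^ n) (F i) x)"
  using assms
proof (induction I rule: infinite_finite_induct)
  case (insert i I)
  have "(deriv ^^ n) (\<lambda>x. F i x + (\<Sum>i\<in>I. F i x)) x = (deriv ^^ n) (F i) x + (deriv ^^ n) (\<lambda>x. \<Sum>i\<in>I. F i x) x"
    by (intro higher_deriv_add smooth_intros insert.prems open_UNIV) auto
  with insert show ?case by simp
qed (simp_all add: higher_deriv_zero)

lemma higher_deriv_mult_id:
  assumes "smooth_fun f"
  shows "(deriv ^^ Suc n) (\<lambda>x. x * f x) x = x * (deriv ^^ Suc n) f x + of_nat (Suc n) * (deriv ^^ n) f x"
proof (induction n arbitrary: x)
  case 0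
  have "((\<lambda>x. x * f x) has_field_derivative 1 * f x + deriv f x * x) (at x)"
    by (rule DERIV_mult) (auto intro: smooth_fun_has_deriv assms)
  then show ?case by (simp add: DERIV_imp_deriv algebra_simps)
next
  case (Suc n)
  have eq: "(deriv ^^ Suc n) (\<lambda>x. x * f x) = (\<lambda>x. x * (deriv ^^ Suc n) f x + of_nat (Suc n) * (deriv ^^ n) f x)"
    using Suc by blast
  have D: "((deriv ^^ k) f has_field_derivative (deriv ^^ Suc k) f x) (at x)" for k x
    using smooth_fun_has_deriv(1)[OF smooth_fun_higher_deriv[OF assms]] by simp
  have "((\<lambda>x. x * (deriv ^^ Suc n) f x + of_nat (Suc n) * (deriv ^^ n) f x) has_field_derivative
      (1 * (deriv ^^ Suc n) f x + (deriv ^^ Suc (Suc n)) f x * x) + of_nat (Suc n) * (deriv ^^ Suc n) f x) (at x)"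
    by (intro DERIV_add DERIV_mult DERIV_cmult D DERIV_ident)
  then have "deriv ((deriv ^^ Suc n) (\<lambda>x. x * f x)) x = 
      (1 * (deriv ^^ Suc n) f x + (deriv ^^ Suc (Suc n)) f x * x) + of_nat (Suc n) * (deriv ^^ Suc n) f x"
    unfolding eq by (rule DERIV_imp_deriv)
  then show ?case by (simp add: algebra_simps)
qed

lemma higher_deriv_power_mult:
  assumes "smooth_fun f"
  shows "(deriv ^^ (n + k)) (\<lambda>x. x ^ k * f x) 0 = fact (n + k) / fact n * (deriv ^^ n) f 0"
proof (induction k)
  case (Suc k)
  have "(deriv ^^ Suc (n + k)) (\<lambda>x. x * (x ^ k * f x)) 0 = of_nat (Suc (n + k)) * (deriv ^^ (n + k)) (\<lambda>x. x ^ k * f x) 0"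
    by (subst higher_deriv_mult_id) (auto intro!: smooth_intros assms)
  with Suc show ?case by (simp add: mult.assoc)
qed simp

text \<open>
  Taylor's theorem as an estimate is valid over the real and the complex numbers alike, unlike the
  mean value forms of the remainder.
\<close>

lemma Taylor_remainder_bound:
  assumes "smooth_fun f"
  obtains B where "\<And>x. norm x \<le> 1 \<Longrightarrow>
    norm (f x - (\<Sum>i\<le>n. (deriv ^^ i) f 0 * x ^ i / fact i)) \<le> B * norm x ^ Suc n"
proof -
  have "continuous_on (cball 0 1) ((deriv ^^ Suc n) f)"
    using smooth_fun_higher_deriv[OF assms, of "Suc n"] C_scalar_continuous continuous_on_subset
    unfolding smooth_scalar_def by blast
  then have "bounded ((deriv ^^ Suc n) f ` cball 0 1)"
    by (intro compact_imp_bounded compact_continuous_image) auto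
  then obtain B where B: "\<And>x. x \<in> cball 0 1 \<Longrightarrow> norm ((deriv ^^ Suc n) f x) \<le> B"
    unfolding bounded_iff by blast
  have "norm ((deriv ^^ 0) f x - (\<Sum>i\<le>n. (deriv ^^ i) f 0 * (x - 0) ^ i / fact i))
      \<le> B * norm (x - 0) ^ Suc n / fact n" if "norm x \<le> 1" for x
  proof (rule field_Taylor[where S = "cball 0 1" and f = "\<lambda>i. (deriv ^^ i) f"])
    show "((deriv ^^ i) f has_field_derivative (deriv ^^ Suc i) f z) (at z within cball 0 1)" for i z
      using smooth_fun_has_deriv(1)[OF smooth_fun_higher_deriv[OF assms, of i]]
      by (simp add: has_field_derivative_at_within)
  qed (use that B in auto)
  then show thesis
    by (intro that[of "B / fact n"]) (simp add: field_simps)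
qed

text \<open>
  Induction on \<open>j\<close>: once the lower derivatives vanish, the Taylor expansion of order \<open>j\<close> leaves
  the monomial with coefficient \<open>f\<^sup>(\<^sup>j\<^sup>)(0) / j!\<close>; divide by \<open>x\<^sup>j\<close> and let \<open>x\<close> tend to \<open>0\<close>. The factor \<open>0 ^ (n - j)\<close>
  is \<open>1\<close> for \<open>j = n\<close> and \<open>0\<close> below, so this contains both the vanishing of the lower derivatives
  and a bound on the \<open>n\<close>-th that is linear in \<open>C\<close>. The explicit constant serves to differentiate
  the coefficient \<open>T\<^sup>2\<^sup>i\<close> in a parameter.
\<close>

lemma higher_deriv_bound:
  assumes f: "smooth_fun f"
    and bound: "eventually (\<lambda>x. norm (f x) \<le> C * norm x ^ n) (at 0)"
  shows "j \<le> n \<Longrightarrow> norm ((deriv ^^ j) f 0) \<le> fact j * (C * 0 ^ (n - j))"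
proof (induction j rule: less_induct)
  case (less j)
  have zero: "(deriv ^^ i) f 0 = 0" if "i < j" for i
    using less that by (auto simp: power_0_left)
  obtain B where B: "\<And>x. norm x \<le> 1 \<Longrightarrow>
      norm (f x - (\<Sum>i\<le>j. (deriv ^^ i) f 0 * x ^ i / fact i)) \<le> B * norm x ^ Suc j"
    using Taylor_remainder_bound[OF f, of j] by blast
  have sum: "(\<Sum>i\<le>j. (deriv ^^ i) f 0 * x ^ i / fact i) = (deriv ^^ j) f 0 * x ^ j / fact j" for x
    by (subst sum.remove[of _ j]) (auto simp: zero)
  have "eventually (\<lambda>x. x \<in> cball 0 1 - {0}) (at (0::'a))"
    by (auto simp: eventually_at intro!: exI[of _ 1])
  with bound have ev: "eventually (\<lambda>x. norm ((deriv ^^ j) f 0) / fact j \<le> C * norm x ^ (n - j) + B * norm x) (at (0::'a))"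
  proof eventually_elim
    case (elim x)
    have pos: "norm x ^ j > 0" using elim by simp
    have "norm ((deriv ^^ j) f 0 * x ^ j / fact j) \<le> C * norm x ^ n + B * norm x ^ Suc j"
      using B[of x] elim(2) norm_triangle_sub[of "(deriv ^^ j) f 0 * x ^ j / fact j" "f x"] elim(1)
      by (simp add: sum norm_minus_commute)
    also have "\<dots> = (C * norm x ^ (n - j) + B * norm x) * norm x ^ j"
      using power_add[of "norm x" "n - j" j] less.prems by (simp add: algebra_simps)
    finally have "norm ((deriv ^^ j) f 0) / fact j * norm x ^ j \<le> (C * norm x ^ (n - j) + B * norm x) * norm x ^ j"
      by (simp add: norm_mult norm_divide norm_power)
    then show ?case using pos by (rule mult_right_le_imp_le)
  qed
  have "((\<lambda>x::'a. C * norm x ^ (n - j) + B * norm x) \<longlongrightarrow> C * norm (0::'a) ^ (n - j) + B * norm (0::'a)) (at 0)"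
    by (intro tendsto_intros)
  then have "norm ((deriv ^^ j) f 0) / fact j \<le> C * norm (0::'a) ^ (n - j) + B * norm (0::'a)"
    by (rule tendsto_lowerbound[OF _ ev]) simp
  then show ?case by (simp add: field_simps)
qed

lemma bigo_power_imp_higher_deriv_eq_0:
  assumes "smooth_fun f" "f \<in> O[at 0](\<lambda>x. x ^ n)" "j < n"
  shows "(deriv ^^ j) f 0 = 0"
proof -
  from assms(2) obtain C where "eventually (\<lambda>x. norm (f x) \<le> C * norm x ^ n) (at 0)"
    by (auto elim!: landau_o.bigE simp: norm_power)
  from higher_deriv_bound[OF assms(1) this, of j] assms(3) show ?thesis
    by (simp add: power_0_left)
qed

text \<open>
  Together with \<open>bigo_power_imp_higher_deriv_eq_0\<close> this translates the vanishing of derivatives at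
  \<open>0\<close> into an order of growth; orders add up under multiplication, so products can be handled
  without the Leibniz rule.
\<close>

lemma higher_deriv_eq_0_imp_bigo_power:
  assumes "smooth_fun f" "\<And>j. j < n \<Longrightarrow> (deriv ^^ j) f 0 = 0"
  shows "f \<in> O[at 0](\<lambda>x. x ^ n)"
proof -
  obtain B where B: "\<And>x. norm x \<le> 1 \<Longrightarrow>
      norm (f x - (\<Sum>i\<le>n. (deriv ^^ i) f 0 * x ^ i / fact i)) \<le> B * norm x ^ Suc n"
    using Taylor_remainder_bound[OF assms(1), of n] by blast
  have sum: "(\<Sum>i\<le>n. (deriv ^^ i) f 0 * x ^ i / fact i) = (deriv ^^ n) f 0 * x ^ n / fact n" for x
    by (subst sum.remove[of _ n]) (auto simp: assms(2))
  have "eventually (\<lambda>x. x \<in> cball 0 1) (at (0::'a))"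
    by (auto simp: eventually_at intro!: exI[of _ 1])
  then have "eventually (\<lambda>x. norm (f x) \<le> (\<bar>B\<bar> + norm ((deriv ^^ n) f 0)) * norm (x ^ n)) (at 0)"
  proof eventually_elim
    case (elim x)
    have "norm (f x) \<le> norm ((deriv ^^ n) f 0 * x ^ n / fact n) + B * norm x ^ Suc n"
      using B[of x] elim norm_triangle_sub[of "f x" "(deriv ^^ n) f 0 * x ^ n / fact n"]
      by (simp add: sum)
    also have "\<dots> \<le> norm ((deriv ^^ n) f 0) * norm x ^ n + \<bar>B\<bar> * norm x ^ n"
    proof (rule add_mono)
      have "norm ((deriv ^^ n) f 0 * x ^ n) * 1 \<le> norm ((deriv ^^ n) f 0 * x ^ n) * fact n"
        by (intro mult_left_mono fact_ge_1 norm_ge_zero)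
      then show "norm ((deriv ^^ n) f 0 * x ^ n / fact n) \<le> norm ((deriv ^^ n) f 0) * norm x ^ n"
        by (simp add: norm_mult norm_divide norm_power divide_le_eq)
      have "B * norm x ^ Suc n \<le> \<bar>B\<bar> * norm x ^ Suc n"
        by (intro mult_right_mono) auto
      also have "\<dots> \<le> \<bar>B\<bar> * norm x ^ n"
        using elim by (intro mult_left_mono power_decreasing) auto
      finally show "B * norm x ^ Suc n \<le> \<bar>B\<bar> * norm x ^ n" .
    qed
    finally show ?case by (simp add: algebra_simps norm_power)
  qed
  then show ?thesis by (rule bigoI)
qed

lemma monomial_bigo_at_0:
  assumes "k \<le> j"
  shows "(\<lambda>x::'k::real_normed_field. a * x ^ j) \<in> O[at 0](\<lambda>x. x ^ k)"
proof (rule bigoI[of _ "norm a"])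
  have "eventually (\<lambda>x. x \<in> cball 0 1) (at (0::'k))"
    by (auto simp: eventually_at intro!: exI[of _ 1])
  then show "eventually (\<lambda>x::'k. norm (a * x ^ j) \<le> norm a * norm (x ^ k)) (at 0)"
    by eventually_elim
      (use assms in \<open>auto simp: norm_mult norm_power intro!: mult_left_mono power_decreasing\<close>)
qed

lemma power_bigo_at_0: "k \<le> j \<Longrightarrow> (\<lambda>x::'k::real_normed_field. x ^ j) \<in> O[at 0](\<lambda>x. x ^ k)"
  using monomial_bigo_at_0[of k j 1] by simp

lemma smooth_fun_bigo_1: "smooth_fun f \<Longrightarrow> f \<in> O[at 0](\<lambda>x. 1)"
  using higher_deriv_eq_0_imp_bigo_power[of f 0] by simp

section \<open>Division by powers of the first coordinate\<close>

lemma continuous_weighted_integrand: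
  fixes f :: "'k::real_or_complex \<times> ('k ^ 'd) \<Rightarrow> 'k"
  assumes "continuous_on UNIV f"
  shows "continuous_on S (\<lambda>(z, t). of_real t ^ j * f (of_real t * fst z, snd z))"
proof -
  have "continuous_on S (\<lambda>p::('k \<times> ('k ^ 'd)) \<times> real. f (of_real (snd p) * fst (fst p), snd (fst p)))"
    by (rule continuous_on_compose2[OF assms]) (auto intro!: continuous_intros)
  then show ?thesis
    by (auto simp: case_prod_beta' intro!: continuous_intros)
qed

text \<open>
  Differentiation under the integral sign. Differentiating in the first coordinate produces another
  factor \<open>t\<close>; the weight \<open>t\<^sup>j\<close> makes the class of integrals closed under differentiation.
\<close>

lemma C_scalar_weighted_integral:
  fixes f :: "'k::real_or_complex \<times> ('k ^ 'd) \<Rightarrow> 'k"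
  assumes "C_scalar pair_scale n UNIV f"
  shows "C_scalar pair_scale n UNIV
    (\<lambda>z. integral (cbox 0 1) (\<lambda>t. of_real t ^ j * f (of_real t * fst z, snd z)))"
  using assms
proof (induction n arbitrary: f j)
  case 0
  then show ?case
    using integral_continuous_on_param[OF continuous_weighted_integrand[of f]] by simp
next
  case (Suc n)
  define I where "I j f z = integral (cbox 0 1) (\<lambda>t. of_real t ^ j * f (of_real t * fst z, snd z))"
    for j and f :: "'k \<times> ('k ^ 'd) \<Rightarrow> 'k" and z
  define E where "E v z = frechet_derivative f (at z) v" for v z
  have der: "(f has_derivative (\<lambda>v. E v z)) (at z)" for z
    unfolding E_def by (rule C_scalar_has_derivative[OF Suc.prems]) simp
  have lin: "linear (\<lambda>v. E v z)" for z
    using der has_derivative_linear by blast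
  have hom: "E (pair_scale a v) z = a * E v z" for z a v
    unfolding E_def by (rule C_scalar_hom[OF Suc.prems]) simp
  have expand: "E (a, w) z = a * E (1,0) z + (\<Sum>p\<in>UNIV. w $ p * E (0, axis p 1) z)" for z a w
    using pair_scale_expand[OF lin hom] .
  have E: "C_scalar pair_scale n UNIV (E v)" for v
    using C_scalar_frechet[OF Suc.prems] by (simp add: E_def[abs_def])
  have contE: "continuous_on UNIV (E v)" for v
    using C_scalar_continuous[OF E] .
  have contf: "continuous_on UNIV f"
    using C_scalar_continuous[OF Suc.prems] .
  have int: "(\<lambda>t. of_real t ^ j * g (of_real t * fst z, snd z)) integrable_on cbox 0 1"
    if "continuous_on UNIV g" for j z and g :: "'k \<times> ('k ^ 'd) \<Rightarrow> 'k"
  proof (rule integrable_continuous)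
    have "continuous_on (cbox 0 1) (\<lambda>t. (\<lambda>(z, t). of_real t ^ j * g (of_real t * fst z, snd z)) (z, t))"
      by (rule continuous_on_compose2[OF continuous_weighted_integrand[OF that, of UNIV j]])
        (auto intro!: continuous_intros)
    then show "continuous_on (cbox 0 1) (\<lambda>t. of_real t ^ j * g (of_real t * fst z, snd z))" by simp
  qed
  define fx where "fx z t = Blinfun (\<lambda>v. of_real t ^ j * E (of_real t * fst v, snd v) (of_real t * fst z, snd z))"
    for z :: "'k \<times> ('k ^ 'd)" and t :: real
  have der_t: "((\<lambda>z. of_real t ^ j * f (of_real t * fst z, snd z)) has_derivative
      (\<lambda>v. of_real t ^ j * E (of_real t * fst v, snd v) (of_real t * fst z, snd z))) (at z)" for t z
    by (rule has_derivative_mult_right, rule has_derivative_compose[OF _ der])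
      (auto intro!: derivative_eq_intros)
  have fx: "blinfun_apply (fx z t) v = of_real t ^ j * E (of_real t * fst v, snd v) (of_real t * fst z, snd z)"
    for z t v
    unfolding fx_def by (rule bounded_linear_Blinfun_apply[THEN fun_cong])
      (rule has_derivative_bounded_linear[OF der_t])
  have fx': "blinfun_apply (fx z t) v = fst v * (of_real t ^ Suc j * E (1, 0) (of_real t * fst z, snd z))
      + (\<Sum>p\<in>UNIV. snd v $ p * (of_real t ^ j * E (0, axis p 1) (of_real t * fst z, snd z)))" for z t v
    unfolding fx expand[of "of_real t * fst v" "snd v"] by (simp add: algebra_simps sum_distrib_left)
  have contE': "continuous_on S (\<lambda>x. E v (of_real (snd x) * fst (fst x), snd (fst x)))" for S v
    using continuous_weighted_integrand[OF contE, of S 0] by (simp add: case_prod_beta)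
  have cont_fx: "continuous_on S (\<lambda>(z, t). fx z t)" for S
  proof (rule continuous_on_blinfun_componentwise)
    fix i :: "'k \<times> ('k ^ 'd)"
    show "continuous_on S (\<lambda>x. blinfun_apply (case x of (z, t) \<Rightarrow> fx z t) i)"
      by (simp only: case_prod_beta fx') (intro continuous_intros contE')
  qed
  have cont_fx1: "continuous_on (cbox 0 1) (fx z)" for z
  proof -
    have "continuous_on (cbox 0 1) (\<lambda>t. (z, t))"
      by (intro continuous_intros)
    from continuous_on_compose2[OF cont_fx[of UNIV] this] show ?thesis by simp
  qed
  have Dapply: "blinfun_apply (integral (cbox 0 1) (fx z)) v
      = fst v * I (Suc j) (E (1, 0)) z + (\<Sum>p\<in>UNIV. snd v $ p * I j (E (0, axis p 1)) z)" for z v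
  proof -
    have "blinfun_apply (integral (cbox 0 1) (fx z)) v = integral (cbox 0 1) (\<lambda>t. blinfun_apply (fx z t) v)"
      using integral_linear[OF integrable_continuous[OF cont_fx1[of z]] blinfun.bounded_linear_left[of v]]
      by (simp add: o_def)
    also have "\<dots> = fst v * I (Suc j) (E (1, 0)) z + (\<Sum>p\<in>UNIV. snd v $ p * I j (E (0, axis p 1)) z)"
      unfolding fx' I_def
      by (simp add: integral_add integral_sum integrable_sum integrable_on_mult_right int contE
          del: box_real power_Suc)
    finally show ?thesis .
  qed
  have der_I: "(I j f has_derivative (\<lambda>v. fst v * I (Suc j) (E (1, 0)) z
      + (\<Sum>p\<in>UNIV. snd v $ p * I j (E (0, axis p 1)) z))) (at z)" for z
  proof -
    have "((\<lambda>z. integral (cbox 0 1) (\<lambda>t. of_real t ^ j * f (of_real t * fst z, snd z)))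
        has_derivative blinfun_apply (integral (cbox 0 1) (fx z))) (at z within UNIV)"
    proof (rule leibniz_rule)
      show "((\<lambda>z. of_real t ^ j * f (of_real t * fst z, snd z)) has_derivative blinfun_apply (fx x t))
        (at x within UNIV)" for x t
        using der_t[of t x] by (simp add: fx[abs_def])
    qed (use int[OF contf] cont_fx in auto)
    moreover have "blinfun_apply (integral (cbox 0 1) (fx z)) = (\<lambda>v. fst v * I (Suc j) (E (1, 0)) z
      + (\<Sum>p\<in>UNIV. snd v $ p * I j (E (0, axis p 1)) z))"
      using Dapply by blast
    ultimately show ?thesis by (simp add: I_def[abs_def])
  qed
  have smooth_I: "C_scalar pair_scale n UNIV (I j' (E v))" for j' v
    using Suc.IH[OF E] by (simp add: I_def[abs_def])
  have "C_scalar pair_scale (Suc n) UNIV (I j f)"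
  proof (rule C_scalar_SucI[OF open_UNIV der_I])
    fix x :: "'k \<times> ('k ^ 'd)" and a v
    show "fst (pair_scale a v) * I (Suc j) (E (1, 0)) x
          + (\<Sum>p\<in>UNIV. snd (pair_scale a v) $ p * I j (E (0, axis p 1)) x)
        = a * (fst v * I (Suc j) (E (1, 0)) x + (\<Sum>p\<in>UNIV. snd v $ p * I j (E (0, axis p 1)) x))"
      by (simp add: pair_scale_eq algebra_simps sum_distrib_left)
  next
    fix v :: "'k \<times> ('k ^ 'd)"
    show "C_scalar pair_scale n UNIV (\<lambda>x. fst v * I (Suc j) (E (1, 0)) x
          + (\<Sum>p\<in>UNIV. snd v $ p * I j (E (0, axis p 1)) x))"
      by (intro C_scalar_add C_scalar_sum C_scalar_mult C_scalar_const smooth_I open_UNIV)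
  qed
  then show ?case by (simp add: I_def[abs_def])
qed

text \<open>
  Along the segment from \<open>(0, w)\<close> to \<open>(x, w)\<close> the fundamental theorem of calculus gives
  \<open>f (x, w) = x \<integral>\<^sub>0\<^sup>1 \<partial>\<^sub>x f (t x, w) dt\<close>. The parameter \<open>t\<close> is real also when \<open>x\<close> is complex.
\<close>

lemma Hadamard_division:
  fixes f :: "'k::real_or_complex \<times> ('k ^ 'd) \<Rightarrow> 'k"
  assumes f: "smooth_scalar pair_scale UNIV f" and zero: "\<And>w. f (0, w) = 0"
  obtains h where "smooth_scalar pair_scale UNIV h" "\<And>x w. f (x, w) = x * h (x, w)"
proof
  have f1: "C_scalar pair_scale (Suc n) UNIV f" for n
    using f by (rule smooth_scalar_D)
  define E where "E v z = frechet_derivative f (at z) v" for v z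
  define h where "h z = integral (cbox 0 1) (\<lambda>t. of_real t ^ 0 * E (1, 0) (of_real t * fst z, snd z))" for z
  have E: "C_scalar pair_scale n UNIV (E v)" for v n
    using C_scalar_frechet[OF f1] by (simp add: E_def[abs_def])
  show "smooth_scalar pair_scale UNIV h"
    using C_scalar_weighted_integral[OF E, where j=0] by (simp add: smooth_scalar_def h_def[abs_def])
  fix x w
  have der: "(f has_derivative (\<lambda>v. E v z)) (at z)" for z
    unfolding E_def by (rule C_scalar_has_derivative[OF f1]) simp
  have hom: "E (pair_scale a v) z = a * E v z" for z a v
    unfolding E_def by (rule C_scalar_hom[OF f1]) simp
  have "((\<lambda>t. f (of_real t * x, w)) has_vector_derivative x * E (1, 0) (of_real t * x, w)) (at t within {0..1})" for t
  proof -
    have "((\<lambda>t. f (of_real t * x, w)) has_derivative (\<lambda>s. E (of_real s * x, 0) (of_real t * x, w))) (at t within {0..1})"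
      by (rule has_derivative_compose[OF _ der]) (auto intro!: derivative_eq_intros)
    moreover have "E (of_real s * x, 0) z = s *\<^sub>R (x * E (1, 0) z)" for s z
      using hom[of "of_real s * x" "(1, 0)" z] by (simp add: pair_scale_eq scaleR_conv_of_real)
    ultimately show ?thesis by (simp add: has_vector_derivative_def)
  qed
  then have "((\<lambda>t. x * E (1, 0) (of_real t * x, w)) has_integral (f (of_real 1 * x, w) - f (of_real 0 * x, w))) {0..1}"
    by (intro fundamental_theorem_of_calculus) auto
  then have "integral {0..1} (\<lambda>t. x * E (1, 0) (of_real t * x, w))
      = f (of_real 1 * x, w) - f (of_real 0 * x, w)"
    by (rule integral_unique)
  then show "f (x, w) = x * h (x, w)"
    by (simp add: h_def zero)
qed

text \<open>
  The value of the quotient at \<open>x = 0\<close> is read off from \<open>higher_deriv_power_mult\<close>; it vanishes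
  if the next derivative does, which permits the next division.
\<close>

lemma iterated_Hadamard_division:
  fixes f :: "'k::real_or_complex \<times> ('k ^ 'd) \<Rightarrow> 'k"
  assumes "smooth_scalar pair_scale UNIV f"
    and "\<And>w j. j < N \<Longrightarrow> (deriv ^^ j) (\<lambda>x. f (x, w)) 0 = 0"
  shows "\<exists>h. smooth_scalar pair_scale UNIV h \<and> (\<forall>x w. f (x, w) = x ^ N * h (x, w))
    \<and> (\<forall>w. (deriv ^^ N) (\<lambda>x. f (x, w)) 0 = fact N * h (0, w))"
  using assms(2)
proof (induction N)
  case 0
  then show ?case using assms(1) by auto
next
  case (Suc N)
  then obtain h where h: "smooth_scalar pair_scale UNIV h" "\<And>x w. f (x, w) = x ^ N * h (x, w)"
    "\<And>w. (deriv ^^ N) (\<lambda>x. f (x, w)) 0 = fact N * h (0, w)"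
    by (metis less_Suc_eq)
  have "h (0, w) = 0" for w
    using h(3)[of w] Suc.prems[of N w] by simp
  then obtain h1 where h1: "smooth_scalar pair_scale UNIV h1" "\<And>x w. h (x, w) = x * h1 (x, w)"
    using Hadamard_division[OF h(1)] by metis
  have eq: "f (x, w) = x ^ Suc N * h1 (x, w)" for x w
    using h(2) h1(2) by simp
  have "smooth_fun (\<lambda>x. h1 (x, w))" for w
    by (rule smooth_fun_along_curve[OF h1(1)]) (intro smooth_scalar_const open_UNIV)
  from higher_deriv_power_mult[OF this, of 0 "Suc N"]
  have "(deriv ^^ Suc N) (\<lambda>x. f (x, w)) 0 = fact (Suc N) * h1 (0, w)" for w
    by (simp add: eq)
  with eq h1(1) show ?case by blast
qed

section \<open>Smooth implicit functions\<close>

lemma C_scalar_Suc_of_derivative: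
  fixes f :: "'k::real_or_complex \<Rightarrow> 'k"
  assumes "open S" "\<And>x. x \<in> S \<Longrightarrow> (f has_field_derivative D x) (at x)" "C_scalar (*) n S D"
  shows "C_scalar (*) (Suc n) S f"
  by (rule C_scalar_SucI[where D = "\<lambda>x v. D x * v"])
    (use assms in \<open>auto simp: has_field_derivative_def mult.left_commute intro!: C_scalar_mult C_scalar_const\<close>)

lemma matrix_inv_inverse:
  fixes A :: "'a::semiring_1 ^ 'n ^ 'm"
  assumes "invertible A"
  shows "A ** matrix_inv A = mat 1 \<and> matrix_inv A ** A = mat 1"
  using assms unfolding matrix_inv_def invertible_def by (rule someI_ex)

text \<open>
  The inverse function theorem, applied to \<open>\<Psi> (x, w) = (x, H (x, w))\<close>, gives a differentiable solution.
  Differentiating \<open>H (x, u x) = 0\<close> and solving by Cramer's rule expresses \<open>u'\<close> as a quotient of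
  determinants whose entries are smooth functions of \<open>(x, u x)\<close>. Hence \<open>u'\<close> is as often
  differentiable as \<open>u\<close>, and by induction \<open>u\<close> is smooth. The same formula shows that the
  derivative is linear over \<open>'k\<close>, although the inverse function theorem only speaks of real
  derivatives.
\<close>

lemma implicit_function_smooth:
  fixes H :: "'k::real_or_complex \<times> ('k ^ 'd) \<Rightarrow> 'k ^ 'd"
  assumes H: "\<And>p. smooth_scalar pair_scale UNIV (\<lambda>z. H z $ p)"
    and zero: "H (0, u0) = 0"
    and det: "det (\<chi> p q. partial_y (\<lambda>z. H z $ p) q (0, u0)) \<noteq> 0"
  obtains U u where "open U" "0 \<in> U" "u 0 = u0" "\<And>x. x \<in> U \<Longrightarrow> H (x, u x) = 0"
    "\<And>p. smooth_scalar (*) U (\<lambda>x. u x $ p)"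
proof -
  define E where "E v z = (\<chi> p. frechet_derivative (\<lambda>z. H z $ p) (at z) v)" for v z
  have H1: "C_scalar pair_scale (Suc 0) UNIV (\<lambda>z. H z $ p)" for p
    using H by (rule smooth_scalar_D)
  have derH: "(H has_derivative (\<lambda>v. E v z)) (at z)" for z
    using has_derivative_vec_lambda[of "\<lambda>p z. H z $ p", OF C_scalar_has_derivative[OF H1]]
    by (simp add: E_def)
  have blH: "bounded_linear (\<lambda>v. E v z)" for z
    using derH has_derivative_bounded_linear by blast
  have hom: "E (pair_scale a v) z = a *s E v z" for a v z
    using C_scalar_hom[OF H1, where x = z and a = a and v = v] by (simp add: E_def vec_eq_iff)
  define M where "M z = (\<chi> p q. partial_y (\<lambda>z. H z $ p) q z)" for z
  have expand: "E (a, w) z = a *s E (1, 0) z + M z *v w" for a w z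
  proof -
    have "E (a, w) z $ p = a * E (1, 0) z $ p + (\<Sum>q\<in>UNIV. w $ q * E (0, axis q 1) z $ p)" for p
    proof -
      have "linear (\<lambda>v. E v z $ p)"
        by (rule bounded_linear.linear[OF bounded_linear_compose[OF bounded_linear_vec_nth blH]])
      from pair_scale_expand[OF this, where a = a and w = w] show ?thesis by (simp add: hom)
    qed
    then show ?thesis
      by (simp add: vec_eq_iff matrix_vector_mult_def M_def partial_y_def E_def mult.commute)
  qed
  have E0: "E (0, w) z = M z *v w" for w z
    using expand[of 0 w z] by simp
  define \<Psi> where "\<Psi> z = (fst z, H z)" for z
  define \<Psi>' where "\<Psi>' z = Blinfun (\<lambda>v. (fst v, E v z))" for z
  have bl: "bounded_linear (\<lambda>v. (fst v, E v z))" for z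
    by (intro bounded_linear_Pair bounded_linear_fst blH)
  have \<Psi>': "blinfun_apply (\<Psi>' z) v = (fst v, E v z)" for z v
    unfolding \<Psi>'_def by (simp add: bounded_linear_Blinfun_apply[OF bl])
  have der\<Psi>: "(\<Psi> has_derivative blinfun_apply (\<Psi>' z)) (at z)" for z
    unfolding \<Psi>_def \<Psi>'[abs_def] by (intro has_derivative_Pair derH) (auto intro!: derivative_eq_intros)
  have cont: "continuous_on UNIV \<Psi>'"
  proof (rule continuous_on_blinfun_componentwise)
    fix i :: "'k \<times> ('k ^ 'd)"
    have "continuous_on UNIV (\<lambda>z. frechet_derivative (\<lambda>z. H z $ p) (at z) i)" for p
      by (rule C_scalar_continuous[OF C_scalar_frechet[OF H1]])
    then show "continuous_on UNIV (\<lambda>z. blinfun_apply (\<Psi>' z) i)"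
      unfolding \<Psi>' E_def by (intro continuous_on_Pair continuous_on_const continuous_on_vec_lambda)
  qed
  define N where "N = matrix_inv (M (0, u0))"
  have inv: "invertible (M (0, u0))"
    using det by (simp add: invertible_det_nz M_def)
  have NM: "N ** M (0, u0) = mat 1"
    unfolding N_def using matrix_inv_inverse[OF inv] by simp
  have lin: "linear (\<lambda>v. (fst v, N *v (snd v - fst v *s E (1, 0) (0, u0))))"
    by (rule linearI)
      (simp_all add: matrix_vector_mult_def vec_eq_iff algebra_simps sum.distrib sum_subtractf scaleR_sum_right)
  \<comment> \<open>The inverse of \<open>(a, w) \<mapsto> (a, a e + M w)\<close> with \<open>e = E (1, 0)\<close>, the derivative of \<open>\<Psi>\<close> at \<open>(0, u0)\<close>.\<close>
  define invf where "invf = Blinfun (\<lambda>v. (fst v, N *v (snd v - fst v *s E (1, 0) (0, u0))))"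
  have invf: "blinfun_apply invf v = (fst v, N *v (snd v - fst v *s E (1, 0) (0, u0)))" for v
    unfolding invf_def using lin
    by (simp add: bounded_linear_Blinfun_apply linear_conv_bounded_linear)
  have left: "invf o\<^sub>L \<Psi>' (0, u0) = id_blinfun"
  proof (rule blinfun_eqI)
    fix v :: "'k \<times> ('k ^ 'd)"
    have "E v (0, u0) = fst v *s E (1, 0) (0, u0) + M (0, u0) *v snd v"
      using expand[of "fst v" "snd v"] by simp
    then show "blinfun_apply (invf o\<^sub>L \<Psi>' (0, u0)) v = blinfun_apply id_blinfun v"
      by (simp add: invf \<Psi>' matrix_vector_mul_assoc NM)
  qed
  obtain U' V g g' where g: "open U'" "(0, u0) \<in> U'" "open V" "\<Psi> (0, u0) \<in> V" "homeomorphism U' V \<Psi> g"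
    "\<And>y. y \<in> V \<Longrightarrow> (g has_derivative (g' y)) (at y)"
    "\<And>y. y \<in> V \<Longrightarrow> bij (blinfun_apply (\<Psi>' (g y)))"
    using inverse_function_theorem[OF open_UNIV der\<Psi> cont UNIV_I left] by metis
  define U where "U = (\<lambda>x. (x, 0)) -` V"
  define u where "u x = snd (g (x, 0))" for x
  have oU: "open U"
    unfolding U_def using g(3) by (rule open_vimage) (intro continuous_intros)
  have U0: "0 \<in> U" using g(4) by (simp add: U_def \<Psi>_def zero)
  have \<Psi>g: "\<Psi> (g (x, 0)) = (x, 0)" if "x \<in> U" for x
    using homeomorphism_apply2[OF g(5)] that by (simp add: U_def)
  have gx: "g (x, 0) = (x, u x)" if "x \<in> U" for x
    using \<Psi>g[OF that] by (auto simp: \<Psi>_def u_def prod_eq_iff)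
  have Hu: "H (x, u x) = 0" if "x \<in> U" for x
    using \<Psi>g[OF that] gx[OF that] by (simp add: \<Psi>_def)
  have u_0: "u 0 = u0"
    using homeomorphism_apply1[OF g(5,2)] by (simp add: \<Psi>_def zero u_def)
  \<comment> \<open>The derivative of \<open>\<Psi>\<close> remains bijective on the graph of \<open>u\<close>, and \<open>M\<close> is its restriction to \<open>a = 0\<close>.\<close>
  have detM: "det (M (x, u x)) \<noteq> 0" if x: "x \<in> U" for x
  proof -
    have "inj (blinfun_apply (\<Psi>' (x, u x)))"
      using g(7)[of "(x, 0)"] gx[OF x] x by (simp add: U_def bij_def)
    then have inj: "b = b'" if "E (a, b) (x, u x) = E (a, b') (x, u x)" for a b b'
      using that by (auto simp: inj_def \<Psi>')
    have "w = 0" if "M (x, u x) *v w = 0" for w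
      by (rule inj[of 0]) (simp add: E0 that)
    then show ?thesis
      by (subst invertible_det_nz[symmetric], subst invertible_left_inverse, subst matrix_left_invertible_ker) blast
  qed
  \<comment> \<open>The numerators in Cramer's rule for the system \<open>M u' = - E (1, 0)\<close>.\<close>
  define B where "B k x = (\<chi> p q. if q = k then (- E (1, 0) (x, u x)) $ p else M (x, u x) $ p $ q)" for k x
  have der_u: "((\<lambda>x. u x $ k) has_field_derivative det (B k x) / det (M (x, u x))) (at x)" if x: "x \<in> U" for x k
  proof -
    have "((\<lambda>x. g (x, 0)) has_derivative (\<lambda>v. g' (x, 0) (v, 0))) (at x)"
      by (rule has_derivative_compose[OF _ g(6)]) (use x in \<open>auto simp: U_def intro!: derivative_eq_intros\<close>)
    then have "(u has_derivative (\<lambda>v. snd (g' (x, 0) (v, 0)))) (at x)"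
      unfolding u_def by (rule has_derivative_snd)
    then obtain u' where u': "(u has_derivative u') (at x)" by blast
    have "((\<lambda>x. H (x, u x)) has_derivative (\<lambda>v. E (v, u' v) (x, u x))) (at x)"
      by (rule has_derivative_compose[OF _ derH]) (intro has_derivative_Pair has_derivative_ident u')
    moreover have "((\<lambda>x. H (x, u x)) has_derivative (\<lambda>v. 0)) (at x)"
      by (rule has_derivative_transform_within_open[OF has_derivative_const oU x]) (simp add: Hu)
    ultimately have "(\<lambda>v. E (v, u' v) (x, u x)) = (\<lambda>v. 0)"
      by (rule has_derivative_unique)
    then have "E (v, u' v) (x, u x) = 0" for v by meson
    then have "v *s E (1, 0) (x, u x) + M (x, u x) *v u' v = 0" for v
      using expand[of v "u' v" "(x, u x)"] by metis
    then have "M (x, u x) *v u' v = - (v *s E (1, 0) (x, u x))" for v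
      by (simp only: add_eq_0_iff)
    then have Mu: "M (x, u x) *v u' v = (\<chi> p. v * (- E (1, 0) (x, u x) $ p))" for v
      by (simp add: vec_eq_iff)
    have "det (B k x) * v = u' v $ k * det (M (x, u x))" for v
    proof -
      have "u' 1 $ k = det (B k x) / det (M (x, u x))"
        using cramer[OF detM[OF x], of "u' 1" "- E (1, 0) (x, u x)"] Mu[of 1]
        by (simp add: B_def vec_eq_iff)
      moreover have "M (x, u x) *v u' v = M (x, u x) *v (v *s u' 1)"
        using Mu[of 1] by (simp add: Mu[of v] vector_scalar_commute vec_eq_iff)
      then have "u' v = v *s u' 1"
        using detM[OF x] by (metis invertible_det_nz matrix_inv_inverse matrix_vector_mul_assoc matrix_vector_mul_lid)
      ultimately show ?thesis using detM[OF x] by simp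
    qed
    then have "u' v $ k = det (B k x) / det (M (x, u x)) * v" for v
      using detM[OF x] by (simp add: field_simps)
    moreover have "((\<lambda>x. u x $ k) has_derivative (\<lambda>v. u' v $ k)) (at x)"
      by (rule bounded_linear.has_derivative[OF bounded_linear_vec_nth u'])
    ultimately show ?thesis unfolding has_field_derivative_def by (simp only:)
  qed
  have smooth: "C_scalar (*) n U (\<lambda>x. u x $ p)" for n p
  proof (induction n arbitrary: p)
    case 0
    then show ?case
      by (auto intro!: continuous_at_imp_continuous_on DERIV_isCont[OF der_u])
  next
    case (Suc n)
    have comp: "C_scalar (*) n U (\<lambda>x. \<Phi> (x, u x))" if "smooth_scalar pair_scale UNIV \<Phi>" for \<Phi>
      by (rule C_scalar_compose[OF open_UNIV oU, where g = "\<lambda>x. (x, u x)"])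
        (use that Suc oU in \<open>auto simp: smooth_scalar_def intro: C_scalar_linear\<close>)
    have cM: "C_scalar (*) n U (\<lambda>x. M (x, u x) $ p $ q)" for p q
      using comp[OF smooth_partial_y[OF H]] by (simp add: M_def)
    have cE: "C_scalar (*) n U (\<lambda>x. E v (x, u x) $ p)" for v p
      using comp[OF smooth_scalar_frechet[OF H]] by (simp add: E_def)
    have cB: "C_scalar (*) n U (\<lambda>x. B k x $ p $ q)" for k p q
      using cM[of p q] C_scalar_minus[OF oU cE[of "(1,0)" p]] by (cases "q = k") (simp_all add: B_def)
    have "C_scalar (*) n U (\<lambda>x. det (B p x) * inverse (det (M (x, u x))))"
      by (intro C_scalar_mult oU C_scalar_inverse C_scalar_det cM cB detM)
    then have "C_scalar (*) n U (\<lambda>x. det (B p x) / det (M (x, u x)))"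
      by (simp add: divide_inverse)
    with der_u show ?case by (intro C_scalar_Suc_of_derivative oU)
  qed
  show thesis
    by (rule that[OF oU U0 u_0 Hu]) (use smooth in \<open>auto simp: smooth_scalar_def\<close>)
qed

section \<open>Taylor expansion along curves\<close>

lemma has_field_derivative_along_line:
  fixes g :: "'k::real_or_complex \<times> ('k ^ 'd) \<Rightarrow> 'k"
  assumes "smooth_scalar pair_scale UNIV g"
  shows "((\<lambda>s. g (x, y + s *s h)) has_field_derivative
    (\<Sum>q\<in>UNIV. h $ q * partial_y g q (x, y + s *s h))) (at s)"
proof -
  let ?z = "(x, y + s *s h)"
  define D where "D = frechet_derivative g (at ?z)"
  have C: "C_scalar pair_scale (Suc 0) UNIV g"
    using assms by (rule smooth_scalar_D)
  have der: "(g has_derivative D) (at ?z)"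
    unfolding D_def by (rule C_scalar_has_derivative[OF C]) simp
  have hom: "D (pair_scale a v) = a * D v" for a v
    unfolding D_def by (rule C_scalar_hom[OF C]) simp
  have expand: "D (a, w) = a * D (1, 0) + (\<Sum>p\<in>UNIV. w $ p * D (0, axis p 1))" for a w
    by (rule pair_scale_expand[OF has_derivative_linear[OF der] hom])
  have vec: "y + s *s h = (\<chi> q. y $ q + s * h $ q)" for s
    by (simp add: vec_eq_iff)
  have "((\<lambda>s. (x, y + s *s h)) has_derivative (\<lambda>v. (0, \<chi> q. v * h $ q))) (at s)"
    unfolding vec by (intro has_derivative_Pair has_derivative_vec_lambda) (auto intro!: derivative_eq_intros)
  from has_derivative_compose[OF this der]
  have "((\<lambda>s. g (x, y + s *s h)) has_derivative (\<lambda>v. D (0, \<chi> q. v * h $ q))) (at s)" .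
  moreover have "D (0, \<chi> q. v * h $ q) = (\<Sum>q\<in>UNIV. h $ q * partial_y g q ?z) * v" for v
    by (subst expand) (simp add: partial_y_def D_def sum_distrib_left mult_ac)
  ultimately show ?thesis by (simp add: has_field_derivative_def)
qed

lemma norm_vec_le_components:
  fixes h :: "'k::real_normed_vector ^ 'd"
  assumes "\<And>q. norm (h $ q) \<le> b"
  shows "norm h \<le> real CARD('d) * b"
proof -
  have "norm h \<le> (\<Sum>q\<in>UNIV. norm (h $ q))"
    unfolding norm_vec_def by (rule L2_set_le_sum) simp
  also have "\<dots> \<le> (\<Sum>q\<in>(UNIV::'d set). b)"
    by (intro sum_mono assms)
  finally show ?thesis by simp
qed

text \<open>
  Taylor's formula of order one for \<open>s \<mapsto> g (x, y + s h)\<close> on the unit ball of \<open>'k\<close>. The second derivative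
  is a quadratic form in \<open>h\<close> whose coefficients are bounded on compact sets. The constant does not
  depend on \<open>h\<close>, which permits perturbations that carry a parameter.
\<close>

lemma second_order_Taylor:
  fixes g :: "'k::real_or_complex \<times> ('k ^ 'd) \<Rightarrow> 'k"
  assumes g: "smooth_scalar pair_scale UNIV g"
  obtains C where "C \<ge> 0" "\<And>x y h b. norm (x, y) \<le> R \<Longrightarrow> (\<And>q. norm (h $ q) \<le> b) \<Longrightarrow> b \<le> 1 \<Longrightarrow>
    norm (g (x, y + h) - g (x, y) - (\<Sum>q\<in>UNIV. h $ q * partial_y g q (x, y))) \<le> C * b\<^sup>2"
proof -
  define E where "E p q = partial_y (partial_y g p) q" for p q
  \<comment> \<open>The points \<open>(x, y + s h)\<close> with \<open>|s| \<le> 1\<close> lie in \<open>K\<close>, because \<open>|h|\<close> is at most the number of components.\<close>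
  define K where "K = cball (0 :: 'k \<times> ('k ^ 'd)) (R + real CARD('d))"
  have "\<exists>M. \<forall>z\<in>K. norm (E p q z) \<le> M" for p q
  proof -
    have "continuous_on K (E p q)"
      unfolding E_def by (rule continuous_on_subset[OF C_scalar_continuous[OF smooth_scalar_D]])
        (auto intro!: smooth_partial_y g)
    then have "bounded (E p q ` K)"
      unfolding K_def by (intro compact_imp_bounded compact_continuous_image) auto
    then show ?thesis by (auto simp: bounded_iff)
  qed
  then obtain M where M: "\<And>p q z. z \<in> K \<Longrightarrow> norm (E p q z) \<le> M p q"
    by metis
  define C where "C = (\<Sum>p\<in>UNIV. \<Sum>q\<in>UNIV. \<bar>M p q\<bar>)"
  show thesis
  proof (rule that[of C])
    show "C \<ge> 0" by (simp add: C_def sum_nonneg)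
    fix x :: 'k and y h :: "'k ^ 'd" and b
    assume R: "norm (x, y) \<le> R" and h: "\<And>q. norm (h $ q) \<le> b" and b: "b \<le> (1::real)"
    have b0: "b \<ge> 0" using h[of undefined] norm_ge_zero order_trans by blast
    define f where "f i s = (if i = 0 then g (x, y + s *s h)
      else if i = 1 then (\<Sum>p\<in>UNIV. h $ p * partial_y g p (x, y + s *s h))
      else (\<Sum>p\<in>UNIV. h $ p * (\<Sum>q\<in>UNIV. h $ q * E p q (x, y + s *s h))))" for i :: nat and s
    have der: "(f i has_field_derivative f (Suc i) s) (at s within cball 0 1)" if "i \<le> 1" for i s
    proof (cases "i = 0")
      case True
      then show ?thesis
        unfolding f_def using has_field_derivative_along_line[OF g]
        by (auto intro: has_field_derivative_at_within)
    next
      case False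
      with that have "i = 1" by simp
      have "((\<lambda>s. \<Sum>p\<in>UNIV. h $ p * partial_y g p (x, y + s *s h)) has_field_derivative
          (\<Sum>p\<in>UNIV. h $ p * (\<Sum>q\<in>UNIV. h $ q * E p q (x, y + s *s h)))) (at s within cball 0 1)"
        unfolding E_def
        by (intro DERIV_sum DERIV_cmult has_field_derivative_at_within[OF has_field_derivative_along_line]
            smooth_partial_y g)
      then show ?thesis using \<open>i = 1\<close> by (simp add: f_def[abs_def])
    qed
    have bound: "norm (f (Suc 1) s) \<le> C * b\<^sup>2" if s: "s \<in> cball 0 1" for s
    proof -
      have "norm ((s *s h) $ q) \<le> 1" for q
        using mult_mono[of "norm s" 1 "norm (h $ q)" b] h[of q] s b b0 by (simp add: norm_mult)
      then have "norm (s *s h) \<le> real CARD('d) * 1"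
        by (rule norm_vec_le_components)
      moreover have "norm ((x, y) + (0, s *s h)) \<le> norm (x, y) + norm (0::'k, s *s h)"
        by (rule norm_triangle_ineq)
      ultimately have "(x, y + s *s h) \<in> K"
        using R by (simp add: K_def norm_Pair)
      then have E: "norm (E p q (x, y + s *s h)) \<le> \<bar>M p q\<bar>" for p q
        using M[of _ p q] by (meson abs_ge_self order_trans)
      have "norm (f (Suc 1) s) = norm (\<Sum>p\<in>UNIV. \<Sum>q\<in>UNIV. h $ p * (h $ q * E p q (x, y + s *s h)))"
        by (simp add: f_def sum_distrib_left)
      also have "\<dots> \<le> (\<Sum>p\<in>UNIV. \<Sum>q\<in>UNIV. b * (b * \<bar>M p q\<bar>))"
        by (intro sum_norm_le) (auto simp: norm_mult intro!: mult_mono h E b0)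
      also have "\<dots> = C * b\<^sup>2"
        by (simp add: C_def sum_distrib_left sum_distrib_right power2_eq_square mult_ac)
      finally show ?thesis .
    qed
    have "norm (f 0 1 - (\<Sum>i\<le>1. f i 0 * (1 - 0) ^ i / fact i)) \<le> C * b\<^sup>2 * norm (1 - 0 :: 'k) ^ Suc 1 / fact 1"
      by (rule field_Taylor[where S = "cball 0 1"]) (use der bound in auto)
    then show "norm (g (x, y + h) - g (x, y) - (\<Sum>q\<in>UNIV. h $ q * partial_y g q (x, y))) \<le> C * b\<^sup>2"
      by (simp add: f_def diff_diff_eq)
  qed
qed

lemma perturbation_bigo:
  fixes g :: "'k::real_or_complex \<times> ('k ^ 'd) \<Rightarrow> 'k"
  assumes g: "smooth_scalar pair_scale UNIV g"
    and y: "continuous_on UNIV y"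
    and h: "\<And>q. (\<lambda>x. h x $ q) \<in> O[at 0](\<lambda>x. x ^ k)" and "k > 0"
  shows "(\<lambda>x. g (x, y x + h x) - g (x, y x) - (\<Sum>q\<in>UNIV. h x $ q * partial_y g q (x, y x)))
    \<in> O[at 0](\<lambda>x. x ^ (2 * k))"
proof -
  have "bounded ((\<lambda>x. (x, y x)) ` cball 0 1)"
    by (intro compact_imp_bounded compact_continuous_image continuous_on_Pair continuous_on_id
        continuous_on_subset[OF y]) auto
  then obtain R where R: "\<And>x. x \<in> cball 0 1 \<Longrightarrow> norm (x, y x) \<le> R"
    unfolding bounded_iff by blast
  obtain C where C: "C \<ge> 0" "\<And>x y h b. norm (x, y) \<le> R \<Longrightarrow> (\<And>q. norm (h $ q) \<le> b) \<Longrightarrow> b \<le> 1 \<Longrightarrow>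
    norm (g (x, y + h) - g (x, y) - (\<Sum>q\<in>UNIV. h $ q * partial_y g q (x, y))) \<le> C * b\<^sup>2"
    using second_order_Taylor[OF g, of R] by blast
  have "\<exists>c>0. eventually (\<lambda>x. norm (h x $ q) \<le> c * norm (x ^ k)) (at 0)" for q
    using h[of q] by (elim landau_o.bigE) blast
  then obtain c where c: "\<And>q. c q > 0" "\<And>q. eventually (\<lambda>x. norm (h x $ q) \<le> c q * norm (x ^ k)) (at 0)"
    by metis
  define b where "b = (\<Sum>q\<in>UNIV. c q)"
  have cb: "c q \<le> b" for q
    unfolding b_def using c(1) by (intro member_le_sum) (auto intro: less_imp_le)
  have "eventually (\<lambda>x. \<forall>q. norm (h x $ q) \<le> c q * norm (x ^ k)) (at 0)"
    using c(2) by (rule eventually_all_finite)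
  moreover have "eventually (\<lambda>x. x \<in> cball 0 1) (at (0::'k))"
    by (auto simp: eventually_at intro!: exI[of _ 1])
  moreover have "((\<lambda>x::'k. b * norm (x ^ k)) \<longlongrightarrow> b * norm ((0::'k) ^ k)) (at 0)"
    by (intro tendsto_intros)
  then have "eventually (\<lambda>x::'k. b * norm (x ^ k) < 1) (at 0)"
    by (rule order_tendstoD) (use \<open>k > 0\<close> in \<open>simp add: zero_power\<close>)
  ultimately have "eventually (\<lambda>x. norm (g (x, y x + h x) - g (x, y x) - (\<Sum>q\<in>UNIV. h x $ q * partial_y g q (x, y x)))
    \<le> (C * b\<^sup>2) * norm (x ^ (2 * k))) (at 0)"
  proof eventually_elim
    case (elim x)
    have "norm (h x $ q) \<le> b * norm (x ^ k)" for q
      using elim(1) cb[of q] mult_right_mono[OF cb[of q], of "norm (x ^ k)"] order_trans by fastforce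
    from C(2)[OF R[OF elim(2)] this] elim(3)
    have "norm (g (x, y x + h x) - g (x, y x) - (\<Sum>q\<in>UNIV. h x $ q * partial_y g q (x, y x)))
      \<le> C * (b * norm (x ^ k))\<^sup>2" by simp
    then show ?case
      by (simp add: power_mult_distrib norm_power power_mult mult.assoc mult.commute[of 2 k])
  qed
  then show ?thesis by (rule bigoI)
qed

definition taylor_curve :: "(nat \<Rightarrow> 'k::real_or_complex ^ 'd) \<Rightarrow> nat \<Rightarrow> 'k \<Rightarrow> 'k ^ 'd"
  where "taylor_curve c N x = (\<Sum>j\<le>N. (x ^ j / fact j) *s c j)"

lemma smooth_scalar_monomial:
  assumes "open S" "smooth_scalar sc S f"
  shows "smooth_scalar sc S (\<lambda>z. f z ^ j * b / a)"
proof -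
  have "smooth_scalar sc S (\<lambda>z. f z ^ j * (b * inverse a))"
    by (intro smooth_scalar_mult smooth_scalar_power smooth_scalar_const assms)
  then show ?thesis by (simp add: divide_inverse mult.assoc)
qed

lemmas smooth_fun_monomial = smooth_scalar_monomial[OF open_UNIV smooth_fun_id]

lemma smooth_scalar_taylor_curve:
  assumes "open S" "smooth_scalar sc S f"
  shows "smooth_scalar sc S (\<lambda>z. taylor_curve c N (f z) $ q)"
proof -
  have "smooth_scalar sc S (\<lambda>z. \<Sum>j\<le>N. f z ^ j * c j $ q / fact j)"
    by (intro smooth_scalar_sum smooth_scalar_monomial assms)
  then show ?thesis by (simp add: taylor_curve_def)
qed

lemmas smooth_taylor_curve = smooth_scalar_taylor_curve[OF open_UNIV smooth_fun_id]

lemma continuous_taylor_curve: "continuous_on UNIV (taylor_curve c N)"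
proof -
  have "continuous_on UNIV (\<lambda>x. \<chi> q. taylor_curve c N x $ q)"
    by (intro continuous_on_vec_lambda C_scalar_continuous[of "(*)" 0]
        smooth_taylor_curve[unfolded smooth_scalar_def, rule_format])
  then show ?thesis by simp
qed

lemma taylor_curve_split:
  "n \<le> N \<Longrightarrow> taylor_curve c N x = taylor_curve c n x + (\<Sum>j=Suc n..N. (x ^ j / fact j) *s c j)"
proof -
  assume "n \<le> N"
  then have "{..N} = {..n} \<union> {Suc n..N}" by auto
  then show ?thesis
    unfolding taylor_curve_def by (simp add: sum.union_disjoint)
qed

lemma tail_bigo: "(\<lambda>x::'k::real_or_complex. (\<Sum>j=n..N. (x ^ j / fact j) *s c j) $ q) \<in> O[at 0](\<lambda>x. x ^ n)"
proof -
  have "(\<lambda>x::'k. (c j $ q / fact j) * x ^ j) \<in> O[at 0](\<lambda>x. x ^ n)" if "j \<in> {n..N}" for j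
    using that by (intro monomial_bigo_at_0) simp
  then have "(\<lambda>x::'k. \<Sum>j=n..N. (c j $ q / fact j) * x ^ j) \<in> O[at 0](\<lambda>x. x ^ n)"
    by (intro big_sum_in_bigo)
  also have "(\<lambda>x::'k. \<Sum>j=n..N. (c j $ q / fact j) * x ^ j) = (\<lambda>x. (\<Sum>j=n..N. (x ^ j / fact j) *s c j) $ q)"
    by (intro ext) (simp add: field_simps)
  finally show ?thesis .
qed

text \<open>
  Truncating the curve at any order \<open>N \<ge> n\<close> gives the same coefficient, because the terms of order
  above \<open>n\<close> change \<open>G\<close> along the curve only by \<open>O(x\<^sup>n\<^sup>+\<^sup>1)\<close>. One fixed curve can therefore be used
  for all coefficients at once.
\<close>

lemma T_coeff_eq_higher_deriv:
  fixes G :: "'k::real_or_complex \<times> ('k ^ 'd) \<Rightarrow> 'k ^ 'd"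
  assumes G: "smooth_scalar pair_scale UNIV (\<lambda>z. G z $ p)" and "n \<le> N"
  shows "T_coeff G n (graph_coeffs c) $ p = (deriv ^^ n) (\<lambda>x. G (x, taylor_curve c N x) $ p) 0"
proof (cases "n = 0")
  case True
  have "taylor_curve c N 0 = (\<Sum>j\<le>N. if j = 0 then c 0 else 0)"
    unfolding taylor_curve_def by (intro sum.cong) (auto simp: power_0_left)
  with True show ?thesis by (simp add: T_coeff_0 graph_coeffs_def)
next
  case False
  have curve: "(\<Sum>j\<le>n. pair_scale (x ^ j / fact j) (graph_coeffs c j)) = (x, taylor_curve c n x)" for x :: 'k
  proof -
    have "(\<Sum>j\<le>n. x ^ j / fact j * (if j = 1 then 1 else 0)) = (\<Sum>j\<le>n. if j = 1 then x else 0)"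
      by (intro sum.cong) auto
    also have "\<dots> = x" using False by (simp add: sum.delta)
    finally show ?thesis
      by (simp add: prod_eq_iff fst_sum snd_sum pair_scale_eq graph_coeffs_def taylor_curve_def)
  qed
  define g where "g z = G z $ p" for z
  have g: "smooth_scalar pair_scale UNIV g" using G by (simp add: g_def[abs_def])
  define h where "h x = (\<Sum>j=Suc n..N. (x ^ j / fact j) *s c j)" for x
  have hb: "(\<lambda>x. h x $ q) \<in> O[at 0](\<lambda>x. x ^ Suc n)" for q
    unfolding h_def by (rule tail_bigo)
  have "(\<lambda>x. g (x, taylor_curve c n x + h x) - g (x, taylor_curve c n x)
      - (\<Sum>q\<in>UNIV. h x $ q * partial_y g q (x, taylor_curve c n x))) \<in> O[at 0](\<lambda>x. x ^ (2 * Suc n))"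
    by (intro perturbation_bigo g continuous_taylor_curve hb) simp
  then have 1: "(\<lambda>x. g (x, taylor_curve c n x + h x) - g (x, taylor_curve c n x)
      - (\<Sum>q\<in>UNIV. h x $ q * partial_y g q (x, taylor_curve c n x))) \<in> O[at 0](\<lambda>x. x ^ Suc n)"
    by (rule landau_o.big_trans) (rule power_bigo_at_0, simp)
  have "(\<lambda>x. h x $ q * partial_y g q (x, taylor_curve c n x)) \<in> O[at 0](\<lambda>x. x ^ Suc n * 1)" for q
    by (intro landau_o.big.mult hb smooth_fun_bigo_1 smooth_fun_along_curve smooth_partial_y g smooth_taylor_curve)
  then have 2: "(\<lambda>x. \<Sum>q\<in>UNIV. h x $ q * partial_y g q (x, taylor_curve c n x)) \<in> O[at 0](\<lambda>x. x ^ Suc n)"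
    by (intro big_sum_in_bigo) simp
  have "(\<lambda>x. g (x, taylor_curve c N x) - g (x, taylor_curve c n x)) \<in> O[at 0](\<lambda>x. x ^ Suc n)"
    using sum_in_bigo(1)[OF 1 2] by (simp add: taylor_curve_split[OF \<open>n \<le> N\<close>] h_def)
  then have "(deriv ^^ n) (\<lambda>x. g (x, taylor_curve c N x) - g (x, taylor_curve c n x)) 0 = 0"
    by (rule bigo_power_imp_higher_deriv_eq_0[rotated])
      (auto intro!: smooth_intros smooth_fun_along_curve g smooth_taylor_curve)
  moreover have "(deriv ^^ n) (\<lambda>x. g (x, taylor_curve c N x) - g (x, taylor_curve c n x)) 0
      = (deriv ^^ n) (\<lambda>x. g (x, taylor_curve c N x)) 0 - (deriv ^^ n) (\<lambda>x. g (x, taylor_curve c n x)) 0"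
    by (intro higher_deriv_diff smooth_fun_along_curve g smooth_taylor_curve)
  ultimately show ?thesis
    by (simp add: T_coeff_def curve g_def)
qed

lemma DERIV_from_quadratic_bound:
  fixes f :: "'k::real_or_complex \<Rightarrow> 'k"
  assumes "\<And>s. norm s \<le> 1 \<Longrightarrow> norm (f s - f 0 - s * D) \<le> K * (norm s)\<^sup>2"
  shows "(f has_field_derivative D) (at 0)"
proof -
  have "((\<lambda>s::'k. K * norm s) \<longlongrightarrow> K * norm (0::'k)) (at 0)"
    by (intro tendsto_intros)
  then have lim: "((\<lambda>s::'k. K * norm s) \<longlongrightarrow> 0) (at 0)" by simp
  have "eventually (\<lambda>s. s \<in> cball 0 1 - {0}) (at (0::'k))"
    by (auto simp: eventually_at intro!: exI[of _ 1])
  then have "eventually (\<lambda>s. norm ((f s - f 0) / s - D) \<le> K * norm s) (at 0)"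
  proof eventually_elim
    case (elim s)
    then have "(f s - f 0) / s - D = (f s - f 0 - s * D) / s" by (simp add: diff_divide_distrib)
    then show ?case
      using assms[of s] elim by (simp add: norm_divide field_simps power2_eq_square)
  qed
  then have "((\<lambda>s. (f s - f 0) / s - D) \<longlongrightarrow> 0) (at 0)"
    by (rule Lim_null_comparison[OF _ lim])
  then have "((\<lambda>s. (f s - f 0) / s) \<longlongrightarrow> D) (at 0)"
    by (simp add: LIM_zero_iff)
  then show ?thesis by (simp add: has_field_derivative_iff)
qed

lemma taylor_curve_perturb:
  assumes "i \<le> N"
  shows "taylor_curve (c(i := c i + v)) N x = taylor_curve c N x + (x ^ i / fact i) *s v"
proof -
  have "(\<Sum>j\<le>N. (x ^ j / fact j) *s (c(i := c i + v)) j)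
      = (\<Sum>j\<le>N. (x ^ j / fact j) *s c j + (if j = i then (x ^ i / fact i) *s v else 0))"
    by (intro sum.cong) (auto simp: vector_add_ldistrib)
  with assms show ?thesis
    by (simp add: taylor_curve_def sum.distrib)
qed

text \<open>
  Adding \<open>s e\<^sub>q\<close> to \<open>c\<^sub>i\<close> adds \<open>s x\<^sup>i e\<^sub>q / i!\<close> to the curve, so up to terms quadratic in \<open>s\<close> it changes
  \<open>G\<close> along the curve by \<open>s x\<^sup>i / i!\<close> times the column \<open>q\<close> of \<open>G\<^sub>y\<close>. The \<open>2i\<close>-th derivative at \<open>0\<close> of
  \<open>x\<^sup>i A(x) / i!\<close> is \<open>(2i)! / (i!)\<^sup>2\<close> times \<open>A\<^sup>(\<^sup>i\<^sup>)(0)\<close>. The quadratic terms are bounded by \<open>C |s|\<^sup>2 |x|\<^sup>2\<^sup>i\<close>,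
  so they contribute \<open>O(|s|\<^sup>2)\<close> to that derivative. Estimating them takes the place of an exchange of
  the derivatives in \<open>s\<close> and \<open>x\<close>.
\<close>

lemma T_coeff_y_eq_higher_deriv:
  fixes G :: "'k::real_or_complex \<times> ('k ^ 'd) \<Rightarrow> 'k ^ 'd"
  assumes G: "smooth_scalar pair_scale UNIV (\<lambda>z. G z $ p)" and N: "2 * i \<le> N"
  shows "T_coeff_y G i (graph_coeffs c) $ p $ q = of_nat ((2 * i) choose i) *
    (deriv ^^ i) (\<lambda>x. partial_y (\<lambda>z. G z $ p) q (x, taylor_curve c N x)) 0"
proof -
  define g where "g z = G z $ p" for z
  have g: "smooth_scalar pair_scale UNIV g" using G by (simp add: g_def[abs_def])
  define A where "A x = partial_y g q (x, taylor_curve c N x)" for x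
  have A: "smooth_fun A"
    unfolding A_def by (intro smooth_fun_along_curve smooth_partial_y g smooth_taylor_curve)
  define h where "h s x = (x ^ i / fact i) *s axis q s" for s x :: 'k
  have smooth_shift: "smooth_fun (\<lambda>x. (taylor_curve c N x + h s x) $ r)" for s r
    by (simp add: h_def, intro smooth_intros smooth_taylor_curve smooth_fun_monomial)
      (auto intro!: smooth_fun_monomial)
  \<comment> \<open>The coefficient \<open>T\<^sup>2\<^sup>i\<close> as a function of the perturbation \<open>s\<close>.\<close>
  define \<phi> where "\<phi> s = (deriv ^^ (2 * i)) (\<lambda>x. g (x, taylor_curve c N x + h s x)) 0" for s
  have T: "T_coeff G (2 * i) ((graph_coeffs c)(i := (fst (graph_coeffs c i), snd (graph_coeffs c i) + axis q s))) $ p = \<phi> s" for s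
  proof -
    have "(graph_coeffs c)(i := (fst (graph_coeffs c i), snd (graph_coeffs c i) + axis q s))
        = graph_coeffs (c(i := c i + axis q s))"
      by (auto simp: graph_coeffs_def fun_eq_iff)
    moreover have "taylor_curve (c(i := c i + axis q s)) N x = taylor_curve c N x + h s x" for x
      unfolding h_def using N by (intro taylor_curve_perturb) simp
    ultimately show ?thesis
      using T_coeff_eq_higher_deriv[OF G N, of "c(i := c i + axis q s)"] by (simp add: \<phi>_def g_def)
  qed
  have "bounded ((\<lambda>x. (x, taylor_curve c N x)) ` cball 0 1)"
    by (intro compact_imp_bounded compact_continuous_image continuous_on_Pair continuous_on_id
        continuous_on_subset[OF continuous_taylor_curve]) auto
  then obtain R where R: "\<And>x. x \<in> cball 0 1 \<Longrightarrow> norm (x, taylor_curve c N x) \<le> R"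
    unfolding bounded_iff by blast
  obtain C where C: "C \<ge> 0" "\<And>x y h b. norm (x, y) \<le> R \<Longrightarrow> (\<And>q. norm (h $ q) \<le> b) \<Longrightarrow> b \<le> 1 \<Longrightarrow>
    norm (g (x, y + h) - g (x, y) - (\<Sum>q\<in>UNIV. h $ q * partial_y g q (x, y))) \<le> C * b\<^sup>2"
    using second_order_Taylor[OF g, of R] by blast
  define D where "D = of_nat ((2 * i) choose i) * (deriv ^^ i) A 0"
  have "norm (\<phi> s - \<phi> 0 - s * D) \<le> (fact (2 * i) * C) * (norm s)\<^sup>2" if s: "norm s \<le> 1" for s
  proof -
    define f where "f x = g (x, taylor_curve c N x + h s x) - g (x, taylor_curve c N x)
        - (s / fact i) * (x ^ i * A x)" for x
    have gsm: "smooth_fun (\<lambda>x. g (x, taylor_curve c N x + h s x))" "smooth_fun (\<lambda>x. g (x, taylor_curve c N x))"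
      by (intro smooth_fun_along_curve g smooth_shift smooth_taylor_curve)+
    have xA: "smooth_fun (\<lambda>x. x ^ i * A x)" by (intro smooth_intros A open_UNIV)
    have f: "smooth_fun f"
      unfolding f_def by (intro smooth_intros gsm xA A open_UNIV)
    have "eventually (\<lambda>x. x \<in> cball 0 1) (at (0::'k))"
      by (auto simp: eventually_at intro!: exI[of _ 1])
    then have "eventually (\<lambda>x. norm (f x) \<le> (C * (norm s)\<^sup>2) * norm x ^ (2 * i)) (at 0)"
    proof eventually_elim
      case (elim x)
      have "norm (h s x $ r) \<le> norm s * norm x ^ i" for r
      proof -
        have "norm s * norm x ^ i * 1 \<le> norm s * norm x ^ i * fact i"
          by (intro mult_left_mono fact_ge_1) auto
        then show ?thesis
          by (simp add: h_def axis_def norm_mult norm_divide norm_power divide_le_eq mult.commute)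
      qed
      moreover have "norm s * norm x ^ i \<le> 1"
        using elim s by (intro mult_le_one power_le_one) auto
      ultimately have "norm (g (x, taylor_curve c N x + h s x) - g (x, taylor_curve c N x)
          - (\<Sum>r\<in>UNIV. h s x $ r * partial_y g r (x, taylor_curve c N x))) \<le> C * (norm s * norm x ^ i)\<^sup>2"
        by (rule C(2)[OF R[OF elim]])
      moreover have "(\<Sum>r\<in>UNIV. h s x $ r * partial_y g r (x, taylor_curve c N x)) = (s / fact i) * (x ^ i * A x)"
      proof -
        have "(\<Sum>r\<in>UNIV. h s x $ r * partial_y g r (x, taylor_curve c N x))
            = (\<Sum>r\<in>UNIV. if r = q then (s / fact i) * (x ^ i * A x) else 0)"
          by (intro sum.cong) (auto simp: h_def axis_def A_def)
        then show ?thesis by simp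
      qed
      ultimately show ?case
        by (simp add: f_def power_mult_distrib mult.assoc mult.commute[of 2 i] flip: power_mult)
    qed
    from higher_deriv_bound[OF f this, of "2 * i"]
    have "norm ((deriv ^^ (2 * i)) f 0) \<le> fact (2 * i) * (C * (norm s)\<^sup>2)" by simp
    moreover have "(deriv ^^ (2 * i)) f 0 = \<phi> s - \<phi> 0 - s * D"
    proof -
      have "(deriv ^^ (2 * i)) f 0 = \<phi> s - (deriv ^^ (2 * i)) (\<lambda>x. g (x, taylor_curve c N x)) 0
          - (s / fact i) * (deriv ^^ (2 * i)) (\<lambda>x. x ^ i * A x) 0"
        unfolding f_def \<phi>_def
        by (subst higher_deriv_diff | subst higher_deriv_cmult | intro smooth_intros gsm xA A open_UNIV | rule refl)+
      also have "(deriv ^^ (2 * i)) (\<lambda>x. g (x, taylor_curve c N x)) 0 = \<phi> 0"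
      proof -
        have "h 0 x = 0" for x by (simp add: h_def axis_def vec_eq_iff)
        then show ?thesis by (simp add: \<phi>_def)
      qed
      also have "(deriv ^^ (2 * i)) (\<lambda>x. x ^ i * A x) 0 = fact (2 * i) / fact i * (deriv ^^ i) A 0"
        using higher_deriv_power_mult[OF A, of i i] by (simp add: mult_2)
      also have "(s / fact i) * (fact (2 * i) / fact i * (deriv ^^ i) A 0) = s * D"
        by (simp add: D_def binomial_fact)
      finally show ?thesis .
    qed
    ultimately show ?thesis by (simp add: mult.assoc)
  qed
  then have "(\<phi> has_field_derivative D) (at 0)"
    by (rule DERIV_from_quadratic_bound)
  then have "deriv \<phi> 0 = D" by (rule DERIV_imp_deriv)
  then show ?thesis
    unfolding T_coeff_y_def vec_lambda_beta T by (simp add: D_def A_def[abs_def] g_def[abs_def])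
qed

text \<open>
  The curve on the left is \<open>Y + h\<close> with \<open>h = x\<^sup>m\<^sup>+\<^sup>1 (w - c\<^sub>m\<^sub>+\<^sub>1) / (m + 1)! + O(x\<^sup>m\<^sup>+\<^sup>2)\<close>. Since \<open>A = g\<^sub>y(x, Y)\<close> is
  \<open>O(x\<^sup>m)\<close>, the linear term \<open>A h\<close> agrees with \<open>x\<^sup>m\<^sup>+\<^sup>1 A (w - c\<^sub>m\<^sub>+\<^sub>1) / (m + 1)!\<close> up to \<open>O(x\<^sup>2\<^sup>m\<^sup>+\<^sup>2)\<close>, and
  the quadratic terms are \<open>O(x\<^sup>2\<^sup>m\<^sup>+\<^sup>2)\<close> as well. Up to order \<open>2m + 1\<close> only the derivative of order
  \<open>2m + 1\<close> is affected, by \<open>(2m + 1)! / (m! (m + 1)!)\<close> times \<open>A\<^sup>(\<^sup>m\<^sup>)(0) (w - c\<^sub>m\<^sub>+\<^sub>1)\<close>.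
\<close>

lemma higher_deriv_shifted_curve:
  fixes g :: "'k::real_or_complex \<times> ('k ^ 'd) \<Rightarrow> 'k" and c :: "nat \<Rightarrow> 'k ^ 'd" and m :: nat and w :: "'k ^ 'd"
  defines "Y \<equiv> taylor_curve c (2 * m + 1)"
  assumes g: "smooth_scalar pair_scale UNIV g"
    and vanish: "\<And>q j. j < m \<Longrightarrow> (deriv ^^ j) (\<lambda>x. partial_y g q (x, Y x)) 0 = 0"
    and n: "n \<le> 2 * m + 1"
  shows "(deriv ^^ n) (\<lambda>x. g (x, taylor_curve c m x + (x ^ (m + 1) / fact (m + 1)) *s w)) 0
    = (deriv ^^ n) (\<lambda>x. g (x, Y x)) 0 +
      (if n = 2 * m + 1 then of_nat ((2 * m + 1) choose m) *
        (\<Sum>q\<in>UNIV. (w $ q - c (m + 1) $ q) * (deriv ^^ m) (\<lambda>x. partial_y g q (x, Y x)) 0) else 0)"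
proof -
  define Z where "Z x = taylor_curve c m x + (x ^ (m + 1) / fact (m + 1)) *s w" for x
  define A where "A q x = partial_y g q (x, Y x)" for q x
  have A: "smooth_fun (A q)" for q
    unfolding A_def Y_def by (intro smooth_fun_along_curve smooth_partial_y g smooth_taylor_curve)
  have AO: "A q \<in> O[at 0](\<lambda>x. x ^ m)" for q
    using vanish by (intro higher_deriv_eq_0_imp_bigo_power A) (simp add: A_def[abs_def])
  define d where "d = w - c (m + 1)"
  define r where "r x = (\<Sum>j=m+2..2*m+1. (x ^ j / fact j) *s c j)" for x :: 'k
  have rO: "(\<lambda>x. r x $ q) \<in> O[at 0](\<lambda>x. x ^ (m + 2))" for q
    unfolding r_def by (rule tail_bigo)
  define h where "h x = (x ^ (m + 1) / fact (m + 1)) *s d - r x" for x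
  have Z_eq: "Z x = Y x + h x" for x
  proof -
    have "Y x = taylor_curve c m x + (\<Sum>j=Suc m..2*m+1. (x ^ j / fact j) *s c j)"
      unfolding Y_def by (rule taylor_curve_split) simp
    also have "(\<Sum>j=Suc m..2*m+1. (x ^ j / fact j) *s c j) = (x ^ (m + 1) / fact (m + 1)) *s c (m + 1) + r x"
      unfolding r_def by (subst sum.atLeast_Suc_atMost) auto
    finally show ?thesis by (simp add: Z_def h_def d_def vector_sub_rdistrib vector_ssub_ldistrib)
  qed
  have hO: "(\<lambda>x. h x $ q) \<in> O[at 0](\<lambda>x. x ^ (m + 1))" for q
  proof -
    have "(\<lambda>x. (d $ q / fact (m + 1)) * x ^ (m + 1)) \<in> O[at 0](\<lambda>x. x ^ (m + 1))"
      by (rule monomial_bigo_at_0) simp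
    moreover have "(\<lambda>x. r x $ q) \<in> O[at 0](\<lambda>x. x ^ (m + 1))"
      by (rule landau_o.big_trans[OF rO power_bigo_at_0]) simp
    ultimately have "(\<lambda>x. (d $ q / fact (m + 1)) * x ^ (m + 1) - r x $ q) \<in> O[at 0](\<lambda>x. x ^ (m + 1))"
      by (rule sum_in_bigo)
    moreover have "h x $ q = (d $ q / fact (m + 1)) * x ^ (m + 1) - r x $ q" for x
      by (simp add: h_def)
    ultimately show ?thesis by simp
  qed
  have 1: "(\<lambda>x. g (x, Z x) - g (x, Y x) - (\<Sum>q\<in>UNIV. h x $ q * A q x)) \<in> O[at 0](\<lambda>x. x ^ (2 * (m + 1)))"
    unfolding Z_eq A_def Y_def by (intro perturbation_bigo g continuous_taylor_curve hO) simp
  have pow_eq: "x ^ (m + 2) * x ^ m = x ^ (2 * (m + 1))" for x :: 'k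
    by (subst power_add[symmetric]) (rule arg_cong[where f = "\<lambda>n. x ^ n"], simp)
  have "(\<lambda>x. r x $ q * A q x) \<in> O[at 0](\<lambda>x. x ^ (m + 2) * x ^ m)" for q
    by (intro landau_o.big.mult rO AO)
  then have 2: "(\<lambda>x. \<Sum>q\<in>UNIV. r x $ q * A q x) \<in> O[at 0](\<lambda>x. x ^ (2 * (m + 1)))"
    by (intro big_sum_in_bigo) (simp only: pow_eq)
  define f where "f x = g (x, Z x) - g (x, Y x) - (\<Sum>q\<in>UNIV. (d $ q / fact (m + 1)) * (x ^ (m + 1) * A q x))" for x
  have f_eq: "f x = (g (x, Z x) - g (x, Y x) - (\<Sum>q\<in>UNIV. h x $ q * A q x)) - (\<Sum>q\<in>UNIV. r x $ q * A q x)" for x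
    by (simp add: f_def h_def algebra_simps sum_subtractf)
  have fO: "f \<in> O[at 0](\<lambda>x. x ^ (2 * (m + 1)))"
    unfolding f_eq[abs_def] using 1 2 by (rule sum_in_bigo)
  have gZ: "smooth_fun (\<lambda>x. g (x, Z x))"
  proof (rule smooth_fun_along_curve[OF g])
    show "smooth_fun (\<lambda>x. Z x $ q)" for q
      by (simp only: Z_def vector_add_component vector_smult_component times_divide_eq_left)
        (intro smooth_intros open_UNIV smooth_taylor_curve smooth_fun_monomial)
  qed
  have gY: "smooth_fun (\<lambda>x. g (x, Y x))"
    unfolding Y_def by (intro smooth_fun_along_curve g smooth_taylor_curve)
  have xA: "smooth_fun (\<lambda>x. x ^ k * A q x)" for k q
    by (intro smooth_intros open_UNIV A)
  have sm: "smooth_fun (\<lambda>x. a * (x ^ k * A q x))" for k q a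
    by (intro smooth_intros open_UNIV A)
  have smS: "smooth_fun (\<lambda>x. \<Sum>q\<in>UNIV. (d $ q / fact (m + 1)) * (x ^ (m + 1) * A q x))"
    by (intro smooth_scalar_sum open_UNIV sm)
  have smf: "smooth_fun f"
    unfolding f_def by (intro smooth_scalar_diff open_UNIV gZ gY smS)
  have "(deriv ^^ n) f 0 = 0"
    using n by (intro bigo_power_imp_higher_deriv_eq_0[OF smf fO]) simp
  moreover have "(deriv ^^ n) f 0 = (deriv ^^ n) (\<lambda>x. g (x, Z x)) 0 - (deriv ^^ n) (\<lambda>x. g (x, Y x)) 0
      - (\<Sum>q\<in>UNIV. (d $ q / fact (m + 1)) * (deriv ^^ n) (\<lambda>x. x ^ (m + 1) * A q x) 0)"
  proof -
    have "(deriv ^^ n) f 0 = (deriv ^^ n) (\<lambda>x. g (x, Z x) - g (x, Y x)) 0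
      - (deriv ^^ n) (\<lambda>x. \<Sum>q\<in>UNIV. (d $ q / fact (m + 1)) * (x ^ (m + 1) * A q x)) 0"
      unfolding f_def by (intro higher_deriv_diff smooth_scalar_diff open_UNIV gZ gY smS)
    also have "(deriv ^^ n) (\<lambda>x. g (x, Z x) - g (x, Y x)) 0 = (deriv ^^ n) (\<lambda>x. g (x, Z x)) 0 - (deriv ^^ n) (\<lambda>x. g (x, Y x)) 0"
      by (intro higher_deriv_diff gZ gY)
    also have "(deriv ^^ n) (\<lambda>x. \<Sum>q\<in>UNIV. (d $ q / fact (m + 1)) * (x ^ (m + 1) * A q x)) 0
      = (\<Sum>q\<in>UNIV. (deriv ^^ n) (\<lambda>x. (d $ q / fact (m + 1)) * (x ^ (m + 1) * A q x)) 0)"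
      by (intro higher_deriv_sum sm)
    also have "\<dots> = (\<Sum>q\<in>UNIV. (d $ q / fact (m + 1)) * (deriv ^^ n) (\<lambda>x. x ^ (m + 1) * A q x) 0)"
      by (intro sum.cong refl higher_deriv_cmult xA)
    finally show ?thesis .
  qed
  moreover have "(deriv ^^ n) (\<lambda>x. x ^ (m + 1) * A q x) 0
      = (if n = 2 * m + 1 then fact (2 * m + 1) / fact m * (deriv ^^ m) (A q) 0 else 0)" for q
  proof (cases "n = 2 * m + 1")
    case True
    have "(deriv ^^ (2 * m + 1)) (\<lambda>x. x ^ (m + 1) * A q x) 0
        = fact (2 * m + 1) / fact m * (deriv ^^ m) (A q) 0"
      using higher_deriv_power_mult[OF A[of q], of m "m + 1"] by (simp only: add.assoc[symmetric] mult_2)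
    then show ?thesis by (simp only: True simp_thms if_True)
  next
    case False
    have "(\<lambda>x. x ^ (m + 1) * A q x) \<in> O[at 0](\<lambda>x. x ^ (m + 1) * x ^ m)"
      by (intro landau_o.big.mult AO landau_o.big_refl)
    moreover have "x ^ (m + 1) * x ^ m = x ^ (2 * m + 1)" for x :: 'k
      by (subst power_add[symmetric]) (rule arg_cong[where f = "\<lambda>n. x ^ n"], simp)
    ultimately have "(\<lambda>x. x ^ (m + 1) * A q x) \<in> O[at 0](\<lambda>x. x ^ (2 * m + 1))"
      by (simp only:)
    from bigo_power_imp_higher_deriv_eq_0[OF xA this] False n show ?thesis by simp
  qed
  ultimately have "(deriv ^^ n) (\<lambda>x. g (x, Z x)) 0 = (deriv ^^ n) (\<lambda>x. g (x, Y x)) 0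
      + (\<Sum>q\<in>UNIV. (d $ q / fact (m + 1)) *
          (if n = 2 * m + 1 then fact (2 * m + 1) / fact m * (deriv ^^ m) (A q) 0 else 0))"
    by (simp only: algebra_simps add_0)
  also have "(\<Sum>q\<in>UNIV. (d $ q / fact (m + 1)) *
          (if n = 2 * m + 1 then fact (2 * m + 1) / fact m * (deriv ^^ m) (A q) 0 else 0))
      = (if n = 2 * m + 1 then of_nat ((2 * m + 1) choose m) *
        (\<Sum>q\<in>UNIV. (w $ q - c (m + 1) $ q) * (deriv ^^ m) (A q) 0) else 0)"
  proof (cases "n = 2 * m + 1")
    case True
    have "of_nat ((2 * m + 1) choose m) = (fact (2 * m + 1) / (fact m * fact (m + 1)) :: 'k)"
      by (subst binomial_fact) auto
    then show ?thesis
      unfolding sum_distrib_left if_P[OF True]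
      by (intro sum.cong) (simp_all add: d_def mult_ac del: fact_Suc)
  qed simp
  finally show ?thesis
    unfolding Z_def A_def .
qed

section \<open>The branch of solutions\<close>

lemma C_scalar_of_C_diff_on:
  assumes "open S"
  shows "C_diff_on sc n S f \<Longrightarrow> C_scalar sc n S (\<lambda>x. f x $ p)"
proof (induction n arbitrary: f)
  case 0
  then show ?case by (simp add: continuous_on_component)
next
  case (Suc n)
  show ?case
  proof (rule C_scalar_SucI[OF assms, where D = "\<lambda>x v. frechet_derivative f (at x) v $ p"])
    fix x assume x: "x \<in> S"
    show "((\<lambda>x. f x $ p) has_derivative (\<lambda>v. frechet_derivative f (at x) v $ p)) (at x)"
      using Suc.prems x
      by (intro bounded_linear.has_derivative[OF bounded_linear_vec_nth]) (auto simp: frechet_derivative_works)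
    show "frechet_derivative f (at x) (sc a v) $ p = a * frechet_derivative f (at x) v $ p" for a v
      using Suc.prems x by (auto simp: Vector_Spaces.linear_iff)
  next
    show "C_scalar sc n S (\<lambda>x. frechet_derivative f (at x) v $ p)" for v
      using Suc.prems by (intro Suc.IH) simp
  qed
qed

lemma C_diff_on_of_components:
  fixes u :: "'k::real_or_complex \<Rightarrow> 'k ^ 'd"
  assumes "open U"
  shows "(\<And>p. C_scalar (*) n U (\<lambda>x. u x $ p)) \<Longrightarrow> C_diff_on (*) n U u"
proof (induction n arbitrary: u)
  case 0
  have "continuous_on U (\<lambda>x. \<chi> p. u x $ p)"
    using 0 by (intro continuous_on_vec_lambda) simp
  then show ?case by simp
next
  case (Suc n)
  have der: "(u has_derivative (\<lambda>v. \<chi> p. frechet_derivative (\<lambda>x. u x $ p) (at x) v)) (at x)" if "x \<in> U" for x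
    using has_derivative_vec_lambda[of "\<lambda>p x. u x $ p", OF C_scalar_has_derivative[OF Suc.prems that]] by simp
  have fd: "frechet_derivative u (at x) = (\<lambda>v. \<chi> p. frechet_derivative (\<lambda>x. u x $ p) (at x) v)" if "x \<in> U" for x
    using frechet_derivative_at[OF der[OF that]] by simp
  have vs: "vector_space ((*) :: 'k \<Rightarrow> 'k \<Rightarrow> 'k)"
    by unfold_locales (simp_all add: algebra_simps)
  have "Vector_Spaces.linear (*) (*s) (frechet_derivative u (at x))" if x: "x \<in> U" for x
  proof -
    have "frechet_derivative u (at x) (v + w) = frechet_derivative u (at x) v + frechet_derivative u (at x) w" for v w
      using linear_add[OF has_derivative_linear[OF der[OF x]], of v w] unfolding fd[OF x] .
    moreover have "frechet_derivative u (at x) (a * v) = a *s frechet_derivative u (at x) v" for a v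
      unfolding fd[OF x] by (simp add: vec_eq_iff C_scalar_hom[OF Suc.prems x] del: C_scalar.simps)
    ultimately show ?thesis
      using vs vec.vector_space_axioms by (simp add: Vector_Spaces.linear_iff)
  qed
  moreover have "C_diff_on (*) n U (\<lambda>x. frechet_derivative u (at x) v)" for v
  proof (rule Suc.IH)
    show "C_scalar (*) n U (\<lambda>x. frechet_derivative u (at x) v $ p)" for p
      by (rule C_scalar_cong[OF assms C_scalar_frechet[OF Suc.prems, of p v]]) (simp add: fd)
  qed
  ultimately show ?case
    using der by (auto simp: differentiable_def)
qed

theorem corollary1:
  fixes G :: "'k::real_or_complex \<times> ('k ^ 'd) \<Rightarrow> 'k ^ 'd"
    and c :: "nat \<Rightarrow> 'k ^ 'd"
    and m :: nat
  assumes "m \<ge> 1"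
    and "smooth_on pair_scale UNIV G"
    and "G (0, c 0) = 0"
    and "\<forall>i<m. T_coeff_y G i (graph_coeffs c) = 0"
    and "det (T_coeff_y G m (graph_coeffs c)) \<noteq> 0"
    and "\<forall>k<m. R_bar G k 0 c = 0 \<and> R_bar G k 1 c = 0"
  shows "\<exists>(U :: 'k set) (u :: 'k \<Rightarrow> 'k ^ 'd).
           open U \<and> 0 \<in> U \<and> smooth_on (*) U u \<and>
           u 0 = - ((1 / gamma m (2 * m)) *s
                     (matrix_inv (T_coeff_y G m (graph_coeffs c)) *v R_bar G m 0 c)) \<and>
           (\<forall>x\<in>U. G (x, (\<Sum>i\<le>m. (x ^ i / fact i) *s c i)
                          + (x ^ (m + 1) / fact (m + 1)) *s u x) = 0)"
proof -
  have G: "smooth_scalar pair_scale UNIV (\<lambda>z. G z $ p)" for p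
    using assms(2) unfolding smooth_on_def smooth_scalar_def
    by (intro allI C_scalar_of_C_diff_on open_UNIV) blast
  define Y where "Y = taylor_curve c (2 * m + 1)"
  define A where "A p q x = partial_y (\<lambda>z. G z $ p) q (x, Y x)" for p q x
  define J where "J = T_coeff_y G m (graph_coeffs c)"
  define R where "R = R_bar G m 0 c"
  define \<gamma> :: 'k where "\<gamma> = gamma m (2 * m)"
  have binom0: "of_nat ((2 * i) choose i) \<noteq> (0 :: 'k)" for i
    by simp
  have Ty: "T_coeff_y G i (graph_coeffs c) $ p $ q = of_nat ((2 * i) choose i) * (deriv ^^ i) (A p q) 0"
    if "i \<le> m" for i p q
    unfolding A_def Y_def by (rule T_coeff_y_eq_higher_deriv[OF G]) (use that in simp)
  have vanish: "(deriv ^^ j) (A p q) 0 = 0" if "j < m" for j p q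
    using Ty[of j p q] assms(4) that binom0[of j] by simp
  have T: "T_coeff G n (graph_coeffs c) $ p = (deriv ^^ n) (\<lambda>x. G (x, Y x) $ p) 0" if "n \<le> 2 * m + 1" for n p
    unfolding Y_def by (rule T_coeff_eq_higher_deriv[OF G that])
  have T_low: "T_coeff G n (graph_coeffs c) = 0" if n: "n \<le> 2 * m" for n
  proof (cases "n = 0")
    case True
    then show ?thesis using assms(3) by (simp add: T_coeff_0 graph_coeffs_def)
  next
    case False
    \<comment> \<open>The orders \<open>2k + 1 + l\<close> with \<open>k < m\<close> and \<open>l \<le> 1\<close> are exactly \<open>1, \<dots>, 2m\<close>.\<close>
    define k where "k = (n - 1) div 2"
    define l where "l = (n - 1) mod 2"
    have kl: "n = 2 * k + 1 + l" "k < m" "l = 0 \<or> l = 1"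
      using False n unfolding k_def l_def by auto
    have "R_bar G k l c = 0" using assms(6) kl by auto
    moreover have "(\<Sum>t\<le>k. gamma t (2 * k + l) *s (T_coeff_y G t (graph_coeffs c) *v c (2 * k + 1 + l - t))) = 0"
      using assms(4) kl(2) by (intro sum.neutral) (auto simp: vec_eq_iff matrix_vector_mult_def)
    ultimately show ?thesis unfolding R_bar_def kl(1) by simp
  qed
  have binom: "of_nat ((2 * m + 1) choose m) * (deriv ^^ m) (A p q) 0 = \<gamma> * J $ p $ q" for p q
    unfolding J_def Ty[OF order_refl] \<gamma>_def gamma_def using binom0[of m] by simp
  have \<gamma>0: "\<gamma> \<noteq> 0"
    unfolding \<gamma>_def gamma_def by simp
  \<comment> \<open>The entry \<open>c (m + 1)\<close> is arbitrary. It occurs in \<open>T\<^sup>2\<^sup>m\<^sup>+\<^sup>1\<close> but not in \<open>R\<close>, and it cancels in \<open>F_top\<close>.\<close>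
  have T_top: "T_coeff G (2 * m + 1) (graph_coeffs c) = R + \<gamma> *s (J *v c (m + 1))"
  proof -
    have "(\<Sum>t\<le>m. gamma t (2 * m + 0) *s (T_coeff_y G t (graph_coeffs c) *v c (2 * m + 1 + 0 - t)))
      = (\<Sum>t\<le>m. if t = m then \<gamma> *s (J *v c (m + 1)) else 0)"
      using assms(4) by (intro sum.cong) (auto simp: \<gamma>_def J_def mult_2 vec_eq_iff matrix_vector_mult_def)
    then show ?thesis by (simp add: R_def R_bar_def)
  qed
  define F where "F p z = G (fst z, taylor_curve c m (fst z) + (fst z ^ (m + 1) / fact (m + 1)) *s snd z) $ p"
    for p and z :: "'k \<times> ('k ^ 'd)"
  have lin: "smooth_scalar pair_scale UNIV (\<lambda>z :: 'k \<times> ('k ^ 'd). fst z)"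
    "smooth_scalar pair_scale UNIV (\<lambda>z :: 'k \<times> ('k ^ 'd). snd z $ q)" for q
    unfolding smooth_scalar_def
    by (auto intro!: C_scalar_linear bounded_linear_fst bounded_linear_compose[OF bounded_linear_vec_nth]
        bounded_linear_snd simp: pair_scale_eq)
  define gF where "gF z = (fst z, taylor_curve c m (fst z) + (fst z ^ (m + 1) / fact (m + 1)) *s snd z)"
    for z :: "'k \<times> ('k ^ 'd)"
  have F: "smooth_scalar pair_scale UNIV (F p)" for p
  proof -
    have fst: "C_scalar pair_scale n UNIV (\<lambda>z. fst (gF z))" for n
      using smooth_scalar_D[OF lin(1)] by (simp add: gF_def)
    have "smooth_scalar pair_scale UNIV
        (\<lambda>z. taylor_curve c m (fst z) $ q + (fst z ^ (m + 1) * 1 / fact (m + 1)) * snd z $ q)" for q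
      by (intro smooth_scalar_add smooth_scalar_mult smooth_scalar_monomial smooth_scalar_taylor_curve
          lin open_UNIV)
    from smooth_scalar_D[OF this]
    have snd: "C_scalar pair_scale n UNIV (\<lambda>z. snd (gF z) $ q)" for n q
      by (simp add: gF_def)
    have "C_scalar pair_scale n UNIV (\<lambda>z. G (gF z) $ p)" for n
      by (rule C_scalar_compose[OF open_UNIV open_UNIV subset_UNIV, where \<Phi> = "\<lambda>z. G z $ p" and g = gF,
            OF smooth_scalar_D[OF G] fst snd])
    then show ?thesis
      unfolding smooth_scalar_def F_def gF_def by blast
  qed
  have F_deriv: "(deriv ^^ n) (\<lambda>x. F p (x, w)) 0
      = T_coeff G n (graph_coeffs c) $ p + (if n = 2 * m + 1 then of_nat ((2 * m + 1) choose m) *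
        (\<Sum>q\<in>UNIV. (w $ q - c (m + 1) $ q) * (deriv ^^ m) (A p q) 0) else 0)"
    if n: "n \<le> 2 * m + 1" for n p w
  proof -
    have v: "(deriv ^^ j) (\<lambda>x. partial_y (\<lambda>z. G z $ p) q (x, taylor_curve c (2 * m + 1) x)) 0 = 0" if "j < m" for q j
      using vanish[OF that, of p q] by (simp only: A_def[abs_def] Y_def)
    show ?thesis
      unfolding T[OF n] A_def Y_def using higher_deriv_shifted_curve[OF G v n, where w = w]
      by (simp only: F_def fst_conv snd_conv)
  qed
  have F_low: "(deriv ^^ n) (\<lambda>x. F p (x, w)) 0 = 0" if "n < 2 * m + 1" for n p w
    using F_deriv[of n p w] T_low[of n] that by simp
  have F_top: "(deriv ^^ (2 * m + 1)) (\<lambda>x. F p (x, w)) 0 = (R + \<gamma> *s (J *v w)) $ p" for p w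
  proof -
    have "of_nat ((2 * m + 1) choose m) * (\<Sum>q\<in>UNIV. (w $ q - c (m + 1) $ q) * (deriv ^^ m) (A p q) 0)
      = (\<Sum>q\<in>UNIV. (w $ q - c (m + 1) $ q) * (\<gamma> * J $ p $ q))"
      unfolding sum_distrib_left binom[symmetric] by (intro sum.cong) (simp_all only: mult_ac)
    also have "\<dots> = (\<gamma> *s (J *v w)) $ p - (\<gamma> *s (J *v c (m + 1))) $ p"
      by (simp add: matrix_vector_mult_def sum_distrib_left left_diff_distrib right_diff_distrib sum_subtractf mult_ac)
    finally show ?thesis
      unfolding F_deriv[OF order_refl] T_top by simp
  qed
  have "\<forall>p. \<exists>h. smooth_scalar pair_scale UNIV h \<and> (\<forall>x w. F p (x, w) = x ^ (2 * m + 1) * h (x, w))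
    \<and> (\<forall>w. (deriv ^^ (2 * m + 1)) (\<lambda>x. F p (x, w)) 0 = fact (2 * m + 1) * h (0, w))"
    by (intro allI iterated_Hadamard_division F F_low)
  then obtain h where h: "\<And>p. smooth_scalar pair_scale UNIV (h p)"
    "\<And>p x w. F p (x, w) = x ^ (2 * m + 1) * h p (x, w)"
    "\<And>p w. (R + \<gamma> *s (J *v w)) $ p = fact (2 * m + 1) * h p (0, w)"
    unfolding F_top by metis
  define H where "H z = (\<chi> p. h p z)" for z
  define u0 where "u0 = - ((1 / \<gamma>) *s (matrix_inv J *v R))"
  have invJ: "invertible J"
    using assms(5) by (simp add: invertible_det_nz J_def)
  have "J *v (matrix_inv J *v R) = R"
    using matrix_inv_inverse[OF invJ] by (simp add: matrix_vector_mul_assoc)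
  moreover have "u0 = (- (1 / \<gamma>)) *s (matrix_inv J *v R)"
    by (simp add: u0_def vec_eq_iff)
  ultimately have "J *v u0 = (- (1 / \<gamma>)) *s R"
    by (simp only: vector_scalar_commute)
  then have "R + \<gamma> *s (J *v u0) = 0"
    using \<gamma>0 by (simp add: vec_eq_iff)
  then have H0: "H (0, u0) = 0"
    using h(3)[of u0] by (simp add: H_def vec_eq_iff del: fact_Suc)
  define k where "k = \<gamma> / fact (2 * m + 1)"
  \<comment> \<open>\<open>h p (0, w)\<close> is affine in \<open>w\<close>, so its partial derivatives are its coefficients.\<close>
  have part: "partial_y (h p) q (0, u0) = k * J $ p $ q" for p q
  proof -
    have "h p (0, u0 + s *s axis q 1) = h p (0, u0) + s * (k * J $ p $ q)" for s
    proof -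
      have J: "(J *v axis q 1) $ p = J $ p $ q"
        by (simp add: matrix_vector_mult_def axis_def if_distrib[where f = "\<lambda>a. _ * a"] cong: if_cong)
      have "fact (2 * m + 1) * h p (0, u0 + s *s axis q 1) = fact (2 * m + 1) * h p (0, u0) + s * (\<gamma> * J $ p $ q)"
        unfolding h(3)[symmetric]
        by (simp add: matrix_vector_right_distrib vector_scalar_commute J algebra_simps)
      then show ?thesis by (simp add: k_def field_simps del: fact_Suc)
    qed
    then have "((\<lambda>s. h p (0, u0 + s *s axis q 1)) has_field_derivative k * J $ p $ q) (at 0)"
      by (auto intro!: derivative_eq_intros)
    moreover have "((\<lambda>s. h p (0, u0 + s *s axis q 1)) has_field_derivative partial_y (h p) q (0, u0)) (at 0)"
      using has_field_derivative_along_line[OF h(1), of p 0 u0 "axis q 1" 0]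
      by (simp add: axis_def if_distrib[where f = "\<lambda>a. a * _"] cong: if_cong)
    ultimately show ?thesis by (metis DERIV_unique)
  qed
  have "det (\<chi> p q. partial_y (\<lambda>z. H z $ p) q (0, u0)) = det (mat k ** J)"
    by (rule arg_cong[where f = det])
      (simp add: vec_eq_iff matrix_matrix_mult_def mat_def H_def part if_distrib[where f = "\<lambda>a. a * _"] cong: if_cong)
  also have "\<dots> = k ^ CARD('d) * det J"
    by (simp add: det_mul det_diagonal mat_def)
  finally have det: "det (\<chi> p q. partial_y (\<lambda>z. H z $ p) q (0, u0)) \<noteq> 0"
    using assms(5) \<gamma>0 by (simp add: J_def k_def del: fact_Suc)
  have Hs: "smooth_scalar pair_scale UNIV (\<lambda>z. H z $ p)" for p
    using h(1) by (simp add: H_def)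
  obtain U u where U: "open U" "0 \<in> U" "u 0 = u0" "\<And>x. x \<in> U \<Longrightarrow> H (x, u x) = 0"
    "\<And>p. smooth_scalar (*) U (\<lambda>x. u x $ p)"
    using implicit_function_smooth[OF Hs H0 det] by metis
  have "smooth_on (*) U u"
    using U(5) unfolding smooth_on_def smooth_scalar_def
    by (intro allI C_diff_on_of_components U(1)) blast
  moreover have "G (x, (\<Sum>i\<le>m. (x ^ i / fact i) *s c i) + (x ^ (m + 1) / fact (m + 1)) *s u x) = 0" if "x \<in> U" for x
  proof -
    have "F p (x, u x) = 0" for p
      using h(2)[of p x "u x"] U(4)[OF that] by (simp add: H_def vec_eq_iff)
    then show ?thesis by (simp add: F_def vec_eq_iff taylor_curve_def)
  qed
  moreover have "u 0 = - ((1 / gamma m (2 * m)) *s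
                     (matrix_inv (T_coeff_y G m (graph_coeffs c)) *v R_bar G m 0 c))"
    using U(3) by (simp add: u0_def \<gamma>_def J_def R_def)
  ultimately show ?thesis using U(1,2) by blast
qed

end
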